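(* Let $R$ be a finitely generated, torsion-free, quasi-free $V$-algebra, equipped with the fine bornology and with the filtration defined by a finite generating set. Assume that $R^+\otimes(R^+)^{\mathrm{op}}$ is filtered Noetherian. Then $\Omega^1(R)$ has a connection of finite degree.
   Context: $V$ is a complete discrete valuation ring. Tensor products are over $V$. The fine bornology on a $V$-module has as bounded subsets those contained in a finitely generated $V$-submodule. $R^+=R\oplus V$ is the unitalisation of $R$. $\Omega^0(R)=R$ and, for $n\ge1$, $\Omega^n(R)=R^+\otimes R^{\otimes n}$, with $x_0\otimes x_1\otimes\dots\otimes x_n$ written $x_0\,\mathrm dx_1\dots\mathrm dx_n$; products of forms (in particular the $R$-bimodule structure) are determined by the Leibniz rule $\mathrm d(xy)=x\,\mathrm dy+(\mathrm dx)y$. Equivalently, $\Omega^1(R)=\ker(R^+\otimes R^+\to R^+)$ for the multiplication map. $R$ is quasi-free if the $R$-bimodule $\Omega^1(R)$ is projective. A connection is a $V$-linear map $\nabla\colon\Omega^1(R)\to\Omega^2(R)$ with $\nabla(a\omega)=a\nabla(\omega)$ and $\nabla(\omega a)=\nabla(\omega)a+\omega\,\mathrm da$ for all $a\in R$, $\omega\in\Omega^1(R)$. Finite degree: For a $V$-submodule $M\subseteq R$, let $M^i$ be the $V$-span of $i$-fold products, $M^{(n)}=\sum_{i=1}^nM^i$, and $$\mathcal F^M_r\Omega^jR=\sum_{i_0+\dots+i_j\le r}M^{(i_0)}\,\mathrm dM^{(i_1)}\dots\mathrm dM^{(i_j)}\oplus\sum_{i_1+\dots+i_j\le r}\mathrm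 dM^{(i_1)}\dots\mathrm dM^{(i_j)}$$ (submodules generated by such forms). $\nabla$ has finite degree on a bounded submodule $M$ if there is $a\in\mathbb N$ with $\nabla(\mathcal F^M_n\Omega^1R)\subseteq\mathcal F^M_{n+a}\Omega^2R$ for all $n$. It has finite degree if every bounded subset of $R$ is contained in a bounded submodule on which $\nabla$ has finite degree. Filtrations: For a finite generating set $S$ of $R$, $\mathcal F_nR$ is the $V$-submodule generated by all products of at most $n$ elements of $S$ (by convention $S^{\le0}=\{1\}$, $\mathcal F_0R=V\cdot1$). The induced filtration on $R^+$ is $V\cdot1_{R^+}+\mathcal F_nR$ and that on $R^+\otimes(R^+)^{\mathrm{op}}$ has $n$-th term $\sum_{i+j\le n}\mathcal F_iR^+\otimes\mathcal F_jR^+$. A filtered $V$-algebra is a $V$-algebra $B$ with an increasing sequence of $V$-submodules $\mathcal F_nB$, $n\in\mathbb N$, with union $B$ and $\mathcal F_nB\cdot\mathcal F_mB\subseteq\mathcal F_{n+m}B$. It is (left) filtered Noetherian if for every left ideal $I\subseteq B$ there are finitely many $x_1,\dots,x_n\in I$ generating $I$ and $l\in\mathbb N$ such that for all $m\in\mathbb N$ and $y\in\mathcal F_mB\cap I$ there are $a_i\in\mathcal F_{m+l}B$ with $y=\sum_{i=1}^na_ix_i$. *)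

theory Defs
  imports "HOL-Algebra.Algebra"
begin

section \<open>Complete discrete valuation rings\<close>

locale complete_dvr = principal_domain V for V (structure) +
  assumes unique_nonzero_prime: "\<exists>!P. primeideal P V \<and> P \<noteq> {\<zero>}"
    and complete:
      "\<lbrakk>\<pi> \<in> carrier V; \<pi> \<noteq> \<zero>; primeideal (PIdl \<pi>) V;
        \<And>i. x i \<in> carrier V;
        \<And>k::nat. \<exists>N::nat. \<forall>i\<ge>N. \<forall>j\<ge>N. x i \<ominus> x j \<in> PIdl (\<pi> [^] k)\<rbrakk>
       \<Longrightarrow> \<exists>y\<in>carrier V. \<forall>k::nat. \<exists>N. \<forall>i\<ge>N. x i \<ominus> y \<in> PIdl (\<pi> [^] k)"


section \<open>Modules\<close>

definition submodule_span ::
    "('v, 'z) ring_scheme \<Rightarrow> ('v, 'm, 'y) module_scheme \<Rightarrow> 'm set \<Rightarrow> 'm set" where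
  "submodule_span V M A = \<Inter>{N. submodule N V M \<and> A \<subseteq> N}"

definition linear_maps ::
    "('v, 'z) ring_scheme \<Rightarrow> ('v, 'm, 'y) module_scheme \<Rightarrow> ('v, 'n, 'w) module_scheme \<Rightarrow> ('m \<Rightarrow> 'n) set" where
  "linear_maps V M N =
     {f \<in> carrier M \<rightarrow> carrier N.
        (\<forall>x\<in>carrier M. \<forall>y\<in>carrier M. f (x \<oplus>\<^bsub>M\<^esub> y) = f x \<oplus>\<^bsub>N\<^esub> f y) \<and>
        (\<forall>c\<in>carrier V. \<forall>x\<in>carrier M. f (c \<odot>\<^bsub>M\<^esub> x) = c \<odot>\<^bsub>N\<^esub> f x)}"

definition torsion_free ::
    "('v, 'z) ring_scheme \<Rightarrow> ('v, 'm, 'y) module_scheme \<Rightarrow> bool" where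
  "torsion_free V M \<longleftrightarrow>
     (\<forall>c\<in>carrier V. \<forall>x\<in>carrier M. c \<odot>\<^bsub>M\<^esub> x = \<zero>\<^bsub>M\<^esub> \<longrightarrow> c = \<zero>\<^bsub>V\<^esub> \<or> x = \<zero>\<^bsub>M\<^esub>)"

definition fine_bounded ::
    "('v, 'z) ring_scheme \<Rightarrow> ('v, 'm, 'y) module_scheme \<Rightarrow> 'm set \<Rightarrow> bool" where
  "fine_bounded V M A \<longleftrightarrow>
     (\<exists>F. finite F \<and> F \<subseteq> carrier M \<and> A \<subseteq> submodule_span V M F)"


section \<open>Tensor products\<close>

text \<open>
  The tensor product of \<open>M\<close> and \<open>N\<close> over \<open>V\<close> is the free \<open>V\<close>-module on
  \<open>carrier M \<times> carrier N\<close> modulo the bilinearity relations; its elements are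
  cosets. The \<^const>\<open>mult\<close> and \<^const>\<open>one\<close> fields of records that are only
  meant as modules are left unspecified.
\<close>

definition free_module ::
    "('v, 'z) ring_scheme \<Rightarrow> 'b set \<Rightarrow> ('v, 'b \<Rightarrow> 'v) module" where
  "free_module V B =
     \<lparr>carrier = {f. f ` B \<subseteq> carrier V \<and> (\<forall>b. b \<notin> B \<longrightarrow> f b = \<zero>\<^bsub>V\<^esub>) \<and> finite {b. f b \<noteq> \<zero>\<^bsub>V\<^esub>}},
      monoid.mult = undefined, one = undefined,
      ring.zero = (\<lambda>_. \<zero>\<^bsub>V\<^esub>), add = (\<lambda>f g b. f b \<oplus>\<^bsub>V\<^esub> g b),
      smult = (\<lambda>c f b. c \<otimes>\<^bsub>V\<^esub> f b)\<rparr>"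

definition basis_vector :: "('v, 'z) ring_scheme \<Rightarrow> 'b \<Rightarrow> 'b \<Rightarrow> 'v" where
  "basis_vector V b = (\<lambda>b'. if b' = b then \<one>\<^bsub>V\<^esub> else \<zero>\<^bsub>V\<^esub>)"

definition quotient_module ::
    "('v, 'm, 'y) module_scheme \<Rightarrow> 'm set \<Rightarrow> ('v, 'm set) module" where
  "quotient_module M N =
     \<lparr>carrier = a_rcosets\<^bsub>M\<^esub> N, monoid.mult = undefined, one = undefined,
      ring.zero = N, add = set_add M,
      smult = (\<lambda>c C. \<Union>x\<in>C. N +>\<^bsub>M\<^esub> (c \<odot>\<^bsub>M\<^esub> x))\<rparr>"

definition tensor_relations ::
    "('v, 'z) ring_scheme \<Rightarrow> ('v, 'm, 'y) module_scheme \<Rightarrow> ('v, 'n, 'w) module_scheme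
      \<Rightarrow> ('m \<times> 'n \<Rightarrow> 'v) set" where
  "tensor_relations V M N =
     (let F = free_module V (carrier M \<times> carrier N);
          e = (\<lambda>x y. basis_vector V (x, y)) in
       {e (x \<oplus>\<^bsub>M\<^esub> x') y \<ominus>\<^bsub>F\<^esub> (e x y \<oplus>\<^bsub>F\<^esub> e x' y) | x x' y.
          x \<in> carrier M \<and> x' \<in> carrier M \<and> y \<in> carrier N} \<union>
       {e x (y \<oplus>\<^bsub>N\<^esub> y') \<ominus>\<^bsub>F\<^esub> (e x y \<oplus>\<^bsub>F\<^esub> e x y') | x y y'.
          x \<in> carrier M \<and> y \<in> carrier N \<and> y' \<in> carrier N} \<union>
       {e (c \<odot>\<^bsub>M\<^esub> x) y \<ominus>\<^bsub>F\<^esub> c \<odot>\<^bsub>F\<^esub> e x y | c x y.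
          c \<in> carrier V \<and> x \<in> carrier M \<and> y \<in> carrier N} \<union>
       {e x (c \<odot>\<^bsub>N\<^esub> y) \<ominus>\<^bsub>F\<^esub> c \<odot>\<^bsub>F\<^esub> e x y | c x y.
          c \<in> carrier V \<and> x \<in> carrier M \<and> y \<in> carrier N})"

definition tensor_kernel ::
    "('v, 'z) ring_scheme \<Rightarrow> ('v, 'm, 'y) module_scheme \<Rightarrow> ('v, 'n, 'w) module_scheme
      \<Rightarrow> ('m \<times> 'n \<Rightarrow> 'v) set" where
  "tensor_kernel V M N =
     submodule_span V (free_module V (carrier M \<times> carrier N)) (tensor_relations V M N)"

definition tensor ::
    "('v, 'z) ring_scheme \<Rightarrow> ('v, 'm, 'y) module_scheme \<Rightarrow> ('v, 'n, 'w) module_scheme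
      \<Rightarrow> ('v, ('m \<times> 'n \<Rightarrow> 'v) set) module" where
  "tensor V M N =
     quotient_module (free_module V (carrier M \<times> carrier N)) (tensor_kernel V M N)"

definition pure_tensor ::
    "('v, 'z) ring_scheme \<Rightarrow> ('v, 'm, 'y) module_scheme \<Rightarrow> ('v, 'n, 'w) module_scheme
      \<Rightarrow> 'm \<Rightarrow> 'n \<Rightarrow> ('m \<times> 'n \<Rightarrow> 'v) set" where
  "pure_tensor V M N x y =
     tensor_kernel V M N +>\<^bsub>free_module V (carrier M \<times> carrier N)\<^esub> basis_vector V (x, y)"

text \<open>
  The linear map out of the tensor product induced by a bilinear map \<open>\<beta>\<close>: all
  representatives of a coset have the same image, and \<^const>\<open>the_elem\<close> picks it.
\<close>

definition tensor_lift ::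
    "('v, 'z) ring_scheme \<Rightarrow> ('v, 'p, 'y) module_scheme \<Rightarrow> ('m \<Rightarrow> 'n \<Rightarrow> 'p)
      \<Rightarrow> ('m \<times> 'n \<Rightarrow> 'v) set \<Rightarrow> 'p" where
  "tensor_lift V P \<beta> t =
     the_elem ((\<lambda>f. \<Oplus>\<^bsub>P\<^esub>b\<in>{b. f b \<noteq> \<zero>\<^bsub>V\<^esub>}. f b \<odot>\<^bsub>P\<^esub> \<beta> (fst b) (snd b)) ` t)"


section \<open>Algebras and bimodules\<close>

text \<open>
  Algebras need not be unital; the \<^const>\<open>one\<close> field of \<open>R\<close> is ignored.
\<close>

locale nonunital_algebra = module V R
  for V :: "('v, 'z) ring_scheme" (structure) and R :: "('v, 'r, 'y) module_scheme" (structure) +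
  assumes mult_closed: "\<lbrakk>x \<in> carrier R; y \<in> carrier R\<rbrakk> \<Longrightarrow> x \<otimes>\<^bsub>R\<^esub> y \<in> carrier R"
    and mult_assoc:
      "\<lbrakk>x \<in> carrier R; y \<in> carrier R; z \<in> carrier R\<rbrakk>
        \<Longrightarrow> (x \<otimes>\<^bsub>R\<^esub> y) \<otimes>\<^bsub>R\<^esub> z = x \<otimes>\<^bsub>R\<^esub> (y \<otimes>\<^bsub>R\<^esub> z)"
    and mult_add_left:
      "\<lbrakk>x \<in> carrier R; y \<in> carrier R; z \<in> carrier R\<rbrakk>
        \<Longrightarrow> (x \<oplus>\<^bsub>R\<^esub> y) \<otimes>\<^bsub>R\<^esub> z = x \<otimes>\<^bsub>R\<^esub> z \<oplus>\<^bsub>R\<^esub> y \<otimes>\<^bsub>R\<^esub> z"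
    and mult_add_right:
      "\<lbrakk>x \<in> carrier R; y \<in> carrier R; z \<in> carrier R\<rbrakk>
        \<Longrightarrow> x \<otimes>\<^bsub>R\<^esub> (y \<oplus>\<^bsub>R\<^esub> z) = x \<otimes>\<^bsub>R\<^esub> y \<oplus>\<^bsub>R\<^esub> x \<otimes>\<^bsub>R\<^esub> z"
    and mult_smult_left:
      "\<lbrakk>c \<in> carrier V; x \<in> carrier R; y \<in> carrier R\<rbrakk>
        \<Longrightarrow> (c \<odot>\<^bsub>R\<^esub> x) \<otimes>\<^bsub>R\<^esub> y = c \<odot>\<^bsub>R\<^esub> (x \<otimes>\<^bsub>R\<^esub> y)"
    and mult_smult_right:
      "\<lbrakk>c \<in> carrier V; x \<in> carrier R; y \<in> carrier R\<rbrakk>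
        \<Longrightarrow> x \<otimes>\<^bsub>R\<^esub> (c \<odot>\<^bsub>R\<^esub> y) = c \<odot>\<^bsub>R\<^esub> (x \<otimes>\<^bsub>R\<^esub> y)"

definition unitalisation ::
    "('v, 'z) ring_scheme \<Rightarrow> ('v, 'r, 'y) module_scheme \<Rightarrow> ('v, 'r \<times> 'v) module" where
  "unitalisation V R =
     \<lparr>carrier = carrier R \<times> carrier V,
      monoid.mult = (\<lambda>(x, c) (y, d). (x \<otimes>\<^bsub>R\<^esub> y \<oplus>\<^bsub>R\<^esub> (d \<odot>\<^bsub>R\<^esub> x \<oplus>\<^bsub>R\<^esub> c \<odot>\<^bsub>R\<^esub> y), c \<otimes>\<^bsub>V\<^esub> d)),
      one = (\<zero>\<^bsub>R\<^esub>, \<one>\<^bsub>V\<^esub>),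
      ring.zero = (\<zero>\<^bsub>R\<^esub>, \<zero>\<^bsub>V\<^esub>),
      add = (\<lambda>(x, c) (y, d). (x \<oplus>\<^bsub>R\<^esub> y, c \<oplus>\<^bsub>V\<^esub> d)),
      smult = (\<lambda>a (x, c). (a \<odot>\<^bsub>R\<^esub> x, a \<otimes>\<^bsub>V\<^esub> c))\<rparr>"

definition opposite :: "('v, 'r, 'y) module_scheme \<Rightarrow> ('v, 'r, 'y) module_scheme" where
  "opposite A = A\<lparr>monoid.mult := (\<lambda>x y. y \<otimes>\<^bsub>A\<^esub> x)\<rparr>"

definition tensor_algebra ::
    "('v, 'z) ring_scheme \<Rightarrow> ('v, 'm, 'y) module_scheme \<Rightarrow> ('v, 'n, 'w) module_scheme
      \<Rightarrow> ('v, ('m \<times> 'n \<Rightarrow> 'v) set) module" where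
  "tensor_algebra V A B =
     (let T = tensor V A B in
      T\<lparr>monoid.mult :=
          (\<lambda>s t. tensor_lift V T
            (\<lambda>a b. tensor_lift V T
              (\<lambda>a' b'. pure_tensor V A B (a \<otimes>\<^bsub>A\<^esub> a') (b \<otimes>\<^bsub>B\<^esub> b')) t) s),
        one := pure_tensor V A B \<one>\<^bsub>A\<^esub> \<one>\<^bsub>B\<^esub>\<rparr>)"

definition enveloping_algebra ::
    "('v, 'z) ring_scheme \<Rightarrow> ('v, 'r, 'y) module_scheme
      \<Rightarrow> ('v, (('r \<times> 'v) \<times> ('r \<times> 'v) \<Rightarrow> 'v) set) module" where
  "enveloping_algebra V R =
     tensor_algebra V (unitalisation V R) (opposite (unitalisation V R))"

record ('v, 'r, 'm) bimodule = "('v, 'm) module" +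
  lact :: "'r \<Rightarrow> 'm \<Rightarrow> 'm"
  ract :: "'m \<Rightarrow> 'r \<Rightarrow> 'm"

locale bimodule = nonunital_algebra V R + E?: module V E
  for V :: "('v, 'z) ring_scheme" (structure) and R :: "('v, 'r, 'y) module_scheme" (structure)
    and E :: "('v, 'r, 'm, 'x) bimodule_scheme" (structure) +
  assumes lact_closed: "\<lbrakk>a \<in> carrier R; x \<in> carrier E\<rbrakk> \<Longrightarrow> lact E a x \<in> carrier E"
    and lact_add_left:
      "\<lbrakk>a \<in> carrier R; b \<in> carrier R; x \<in> carrier E\<rbrakk>
        \<Longrightarrow> lact E (a \<oplus>\<^bsub>R\<^esub> b) x = lact E a x \<oplus>\<^bsub>E\<^esub> lact E b x"
    and lact_add_right:
      "\<lbrakk>a \<in> carrier R; x \<in> carrier E; y \<in> carrier E\<rbrakk>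
        \<Longrightarrow> lact E a (x \<oplus>\<^bsub>E\<^esub> y) = lact E a x \<oplus>\<^bsub>E\<^esub> lact E a y"
    and lact_smult_left:
      "\<lbrakk>c \<in> carrier V; a \<in> carrier R; x \<in> carrier E\<rbrakk>
        \<Longrightarrow> lact E (c \<odot>\<^bsub>R\<^esub> a) x = c \<odot>\<^bsub>E\<^esub> lact E a x"
    and lact_smult_right:
      "\<lbrakk>c \<in> carrier V; a \<in> carrier R; x \<in> carrier E\<rbrakk>
        \<Longrightarrow> lact E a (c \<odot>\<^bsub>E\<^esub> x) = c \<odot>\<^bsub>E\<^esub> lact E a x"
    and lact_assoc:
      "\<lbrakk>a \<in> carrier R; b \<in> carrier R; x \<in> carrier E\<rbrakk>
        \<Longrightarrow> lact E (a \<otimes>\<^bsub>R\<^esub> b) x = lact E a (lact E b x)"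
    and ract_closed: "\<lbrakk>a \<in> carrier R; x \<in> carrier E\<rbrakk> \<Longrightarrow> ract E x a \<in> carrier E"
    and ract_add_left:
      "\<lbrakk>a \<in> carrier R; x \<in> carrier E; y \<in> carrier E\<rbrakk>
        \<Longrightarrow> ract E (x \<oplus>\<^bsub>E\<^esub> y) a = ract E x a \<oplus>\<^bsub>E\<^esub> ract E y a"
    and ract_add_right:
      "\<lbrakk>a \<in> carrier R; b \<in> carrier R; x \<in> carrier E\<rbrakk>
        \<Longrightarrow> ract E x (a \<oplus>\<^bsub>R\<^esub> b) = ract E x a \<oplus>\<^bsub>E\<^esub> ract E x b"
    and ract_smult_left:
      "\<lbrakk>c \<in> carrier V; a \<in> carrier R; x \<in> carrier E\<rbrakk>
        \<Longrightarrow> ract E (c \<odot>\<^bsub>E\<^esub> x) a = c \<odot>\<^bsub>E\<^esub> ract E x a"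
    and ract_smult_right:
      "\<lbrakk>c \<in> carrier V; a \<in> carrier R; x \<in> carrier E\<rbrakk>
        \<Longrightarrow> ract E x (c \<odot>\<^bsub>R\<^esub> a) = c \<odot>\<^bsub>E\<^esub> ract E x a"
    and ract_assoc:
      "\<lbrakk>a \<in> carrier R; b \<in> carrier R; x \<in> carrier E\<rbrakk>
        \<Longrightarrow> ract E x (a \<otimes>\<^bsub>R\<^esub> b) = ract E (ract E x a) b"
    and lact_ract:
      "\<lbrakk>a \<in> carrier R; b \<in> carrier R; x \<in> carrier E\<rbrakk>
        \<Longrightarrow> ract E (lact E a x) b = lact E a (ract E x b)"

definition bimodule_homs ::
    "('v, 'z) ring_scheme \<Rightarrow> ('v, 'r, 'y) module_scheme
      \<Rightarrow> ('v, 'r, 'm, 'x) bimodule_scheme \<Rightarrow> ('v, 'r, 'n, 'w) bimodule_scheme \<Rightarrow> ('m \<Rightarrow> 'n) set" where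
  "bimodule_homs V R E Y =
     {f \<in> linear_maps V E Y. \<forall>a\<in>carrier R. \<forall>x\<in>carrier E.
        f (lact E a x) = lact Y a (f x) \<and> f (ract E x a) = ract Y (f x) a}"

text \<open>
  The lifting property of projective bimodules. HOL cannot quantify over the types of
  the test bimodules \<open>E\<close> and \<open>Y\<close> inside a definition, so these are fixed
  to types large enough to include the case \<open>Y = P\<close> with \<open>E\<close> the free bimodule
  on the set \<^term>\<open>carrier P\<close>, that is, finitely supported functions from
  \<^term>\<open>carrier P\<close> to the enveloping algebra. This case makes \<open>P\<close> a direct
  summand of a free bimodule, so the lifting property follows for test bimodules of all types.
\<close>

definition projective_bimodule ::
    "('v, 'z) ring_scheme \<Rightarrow> ('v, 'r, 'y) module_scheme \<Rightarrow> ('v, 'r, 'p) bimodule \<Rightarrow> bool" where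
  "projective_bimodule V R P \<longleftrightarrow>
     bimodule V R P \<and>
     (\<forall>(E :: ('v, 'r, 'p \<Rightarrow> (('r \<times> 'v) \<times> ('r \<times> 'v) \<Rightarrow> 'v) set) bimodule)
       (Y :: ('v, 'r, 'p) bimodule) f g.
        bimodule V R E \<and> bimodule V R Y \<and>
        f \<in> bimodule_homs V R E Y \<and> f ` carrier E = carrier Y \<and>
        g \<in> bimodule_homs V R P Y \<longrightarrow>
        (\<exists>h\<in>bimodule_homs V R P E. \<forall>p\<in>carrier P. f (h p) = g p))"


section \<open>Noncommutative differential forms\<close>

definition unital_bimodule ::
    "('v, 'z) ring_scheme \<Rightarrow> ('v, 'r, 'y) module_scheme \<Rightarrow> ('v, 'r, 'r \<times> 'v) bimodule" where
  "unital_bimodule V R =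
     (let U = unitalisation V R in
      module.extend U (bimodule.fields
        (\<lambda>a x. (a, \<zero>\<^bsub>V\<^esub>) \<otimes>\<^bsub>U\<^esub> x)
        (\<lambda>x a. x \<otimes>\<^bsub>U\<^esub> (a, \<zero>\<^bsub>V\<^esub>))))"

text \<open>
  From a bimodule \<open>E\<close> of forms, \<open>forms_step\<close> builds the bimodule \<open>E \<otimes> R\<close> of
  the forms \<open>\<omega> dy\<close>, where \<open>\<omega> dy\<close> is the pure tensor of \<open>\<omega>\<close> and \<open>y\<close>.
  The Leibniz rule gives \<open>(\<omega> dy) a = \<omega> d(ya) - (\<omega> y) da\<close>.
\<close>

definition forms_step ::
    "('v, 'z) ring_scheme \<Rightarrow> ('v, 'r, 'y) module_scheme \<Rightarrow> ('v, 'r, 'm, 'x) bimodule_scheme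
      \<Rightarrow> ('v, 'r, ('m \<times> 'r \<Rightarrow> 'v) set) bimodule" where
  "forms_step V R E =
     (let T = tensor V E R in
      module.extend T (bimodule.fields
        (\<lambda>a t. tensor_lift V T (\<lambda>\<omega> y. pure_tensor V E R (lact E a \<omega>) y) t)
        (\<lambda>t a. tensor_lift V T
          (\<lambda>\<omega> y. pure_tensor V E R \<omega> (y \<otimes>\<^bsub>R\<^esub> a) \<ominus>\<^bsub>T\<^esub> pure_tensor V E R (ract E \<omega> y) a) t)))"

text \<open>\<open>\<Omega>\<^sup>1(R) = R\<^sup>+ \<otimes> R\<close> and \<open>\<Omega>\<^sup>2(R) = (R\<^sup>+ \<otimes> R) \<otimes> R\<close>.\<close>

definition Omega1 ::
    "('v, 'z) ring_scheme \<Rightarrow> ('v, 'r, 'y) module_scheme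
      \<Rightarrow> ('v, 'r, (('r \<times> 'v) \<times> 'r \<Rightarrow> 'v) set) bimodule" where
  "Omega1 V R = forms_step V R (unital_bimodule V R)"

definition Omega2 ::
    "('v, 'z) ring_scheme \<Rightarrow> ('v, 'r, 'y) module_scheme
      \<Rightarrow> ('v, 'r, ((('r \<times> 'v) \<times> 'r \<Rightarrow> 'v) set \<times> 'r \<Rightarrow> 'v) set) bimodule" where
  "Omega2 V R = forms_step V R (Omega1 V R)"

text \<open>
  \<open>form1 V R u y\<close> is \<open>u dy\<close> for \<open>u\<close> in \<open>R\<^sup>+\<close>, and \<open>form2 V R \<omega> y\<close> is
  \<open>\<omega> dy\<close> for \<open>\<omega>\<close> in \<open>\<Omega>\<^sup>1(R)\<close>.
\<close>

definition form1 ::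
    "('v, 'z) ring_scheme \<Rightarrow> ('v, 'r, 'y) module_scheme
      \<Rightarrow> 'r \<times> 'v \<Rightarrow> 'r \<Rightarrow> (('r \<times> 'v) \<times> 'r \<Rightarrow> 'v) set" where
  "form1 V R = pure_tensor V (unital_bimodule V R) R"

definition form2 ::
    "('v, 'z) ring_scheme \<Rightarrow> ('v, 'r, 'y) module_scheme
      \<Rightarrow> (('r \<times> 'v) \<times> 'r \<Rightarrow> 'v) set \<Rightarrow> 'r \<Rightarrow> ((('r \<times> 'v) \<times> 'r \<Rightarrow> 'v) set \<times> 'r \<Rightarrow> 'v) set" where
  "form2 V R = pure_tensor V (Omega1 V R) R"

definition quasi_free ::
    "('v, 'z) ring_scheme \<Rightarrow> ('v, 'r, 'y) module_scheme \<Rightarrow> bool" where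
  "quasi_free V R \<longleftrightarrow> projective_bimodule V R (Omega1 V R)"

definition forms_connection ::
    "('v, 'z) ring_scheme \<Rightarrow> ('v, 'r, 'y) module_scheme
      \<Rightarrow> ((('r \<times> 'v) \<times> 'r \<Rightarrow> 'v) set \<Rightarrow> ((('r \<times> 'v) \<times> 'r \<Rightarrow> 'v) set \<times> 'r \<Rightarrow> 'v) set) \<Rightarrow> bool" where
  "forms_connection V R nabla \<longleftrightarrow>
     nabla \<in> linear_maps V (Omega1 V R) (Omega2 V R) \<and>
     (\<forall>a\<in>carrier R. \<forall>\<omega>\<in>carrier (Omega1 V R).
        nabla (lact (Omega1 V R) a \<omega>) = lact (Omega2 V R) a (nabla \<omega>) \<and>
        nabla (ract (Omega1 V R) \<omega> a)
          = ract (Omega2 V R) (nabla \<omega>) a \<oplus>\<^bsub>Omega2 V R\<^esub> form2 V R \<omega> a)"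


section \<open>Finite degree\<close>

definition identities :: "('r, 'y) ring_scheme \<Rightarrow> 'r set" where
  "identities R = {e \<in> carrier R. \<forall>x\<in>carrier R. e \<otimes>\<^bsub>R\<^esub> x = x \<and> x \<otimes>\<^bsub>R\<^esub> e = x}"

text \<open>
  The products of exactly \<open>n\<close> elements of \<open>A\<close>. The empty product is the unit element of
  \<open>R\<close>, if there is one.
\<close>

fun products :: "('r, 'y) ring_scheme \<Rightarrow> 'r set \<Rightarrow> nat \<Rightarrow> 'r set" where
  "products R A 0 = identities R"
| "products R A (Suc 0) = A"
| "products R A (Suc (Suc n)) = {x \<otimes>\<^bsub>R\<^esub> y | x y. x \<in> A \<and> y \<in> products R A (Suc n)}"

text \<open>\<open>M\<^sup>(\<^sup>n\<^sup>)\<close>, which is zero for \<open>n = 0\<close>.\<close>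

definition power_sum ::
    "('v, 'z) ring_scheme \<Rightarrow> ('v, 'r, 'y) module_scheme \<Rightarrow> 'r set \<Rightarrow> nat \<Rightarrow> 'r set" where
  "power_sum V R M n = submodule_span V R (\<Union>i\<in>{1..n}. products R M i)"

definition forms_filtration1 ::
    "('v, 'z) ring_scheme \<Rightarrow> ('v, 'r, 'y) module_scheme \<Rightarrow> 'r set
      \<Rightarrow> nat \<Rightarrow> (('r \<times> 'v) \<times> 'r \<Rightarrow> 'v) set set" where
  "forms_filtration1 V R M r =
     submodule_span V (Omega1 V R)
       ({form1 V R (x, \<zero>\<^bsub>V\<^esub>) y | x y i j.
           i + j \<le> r \<and> x \<in> power_sum V R M i \<and> y \<in> power_sum V R M j} \<union>
        {form1 V R (\<zero>\<^bsub>R\<^esub>, \<one>\<^bsub>V\<^esub>) y | y j. j \<le> r \<and> y \<in> power_sum V R M j})"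

definition forms_filtration2 ::
    "('v, 'z) ring_scheme \<Rightarrow> ('v, 'r, 'y) module_scheme \<Rightarrow> 'r set
      \<Rightarrow> nat \<Rightarrow> ((('r \<times> 'v) \<times> 'r \<Rightarrow> 'v) set \<times> 'r \<Rightarrow> 'v) set set" where
  "forms_filtration2 V R M r =
     submodule_span V (Omega2 V R)
       ({form2 V R (form1 V R (x, \<zero>\<^bsub>V\<^esub>) y) z | x y z i j k.
           i + j + k \<le> r \<and> x \<in> power_sum V R M i \<and> y \<in> power_sum V R M j \<and> z \<in> power_sum V R M k} \<union>
        {form2 V R (form1 V R (\<zero>\<^bsub>R\<^esub>, \<one>\<^bsub>V\<^esub>) y) z | y z j k.
           j + k \<le> r \<and> y \<in> power_sum V R M j \<and> z \<in> power_sum V R M k})"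

definition finite_degree_on ::
    "('v, 'z) ring_scheme \<Rightarrow> ('v, 'r, 'y) module_scheme \<Rightarrow> 'r set
      \<Rightarrow> ((('r \<times> 'v) \<times> 'r \<Rightarrow> 'v) set \<Rightarrow> ((('r \<times> 'v) \<times> 'r \<Rightarrow> 'v) set \<times> 'r \<Rightarrow> 'v) set) \<Rightarrow> bool" where
  "finite_degree_on V R M nabla \<longleftrightarrow>
     (\<exists>a. \<forall>n. nabla ` forms_filtration1 V R M n \<subseteq> forms_filtration2 V R M (n + a))"

text \<open>Here \<open>bounded\<close> is the bornology of \<open>R\<close>.\<close>

definition finite_degree ::
    "('v, 'z) ring_scheme \<Rightarrow> ('v, 'r, 'y) module_scheme \<Rightarrow> ('r set \<Rightarrow> bool)
      \<Rightarrow> ((('r \<times> 'v) \<times> 'r \<Rightarrow> 'v) set \<Rightarrow> ((('r \<times> 'v) \<times> 'r \<Rightarrow> 'v) set \<times> 'r \<Rightarrow> 'v) set) \<Rightarrow> bool" where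
  "finite_degree V R bounded nabla \<longleftrightarrow>
     (\<forall>A. A \<subseteq> carrier R \<and> bounded A \<longrightarrow>
        (\<exists>M. A \<subseteq> M \<and> submodule M V R \<and> bounded M \<and> finite_degree_on V R M nabla))"


section \<open>Filtered Noetherian algebras\<close>

definition generates ::
    "('v, 'z) ring_scheme \<Rightarrow> ('v, 'r, 'y) module_scheme \<Rightarrow> 'r set \<Rightarrow> bool" where
  "generates V R S \<longleftrightarrow> S \<subseteq> carrier R \<and> submodule_span V R (\<Union>n. products R S n) = carrier R"

definition gen_filtration ::
    "('v, 'z) ring_scheme \<Rightarrow> ('v, 'r, 'y) module_scheme \<Rightarrow> 'r set \<Rightarrow> nat \<Rightarrow> 'r set" where
  "gen_filtration V R S n = submodule_span V R (\<Union>i\<in>{0..n}. products R S i)"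

text \<open>\<open>V \<cdot> 1 + \<F>\<^sub>n R\<close> inside \<open>R\<^sup>+ = R \<oplus> V\<close>.\<close>

definition unital_filtration ::
    "('v, 'z) ring_scheme \<Rightarrow> ('v, 'r, 'y) module_scheme \<Rightarrow> 'r set \<Rightarrow> nat \<Rightarrow> ('r \<times> 'v) set" where
  "unital_filtration V R S n = gen_filtration V R S n \<times> carrier V"

definition enveloping_filtration ::
    "('v, 'z) ring_scheme \<Rightarrow> ('v, 'r, 'y) module_scheme \<Rightarrow> 'r set
      \<Rightarrow> nat \<Rightarrow> (('r \<times> 'v) \<times> ('r \<times> 'v) \<Rightarrow> 'v) set set" where
  "enveloping_filtration V R S n =
     submodule_span V (enveloping_algebra V R)
       {pure_tensor V (unitalisation V R) (opposite (unitalisation V R)) x y | x y i j.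
          i + j \<le> n \<and> x \<in> unital_filtration V R S i \<and> y \<in> unital_filtration V R S j}"

locale filtered_algebra = nonunital_algebra V B + B?: ring B
  for V :: "('v, 'z) ring_scheme" (structure) and B :: "('v, 'b, 'y) module_scheme" (structure) +
  fixes F :: "nat \<Rightarrow> 'b set"
  assumes filtration_submodule: "submodule (F n) V B"
    and filtration_mono: "m \<le> n \<Longrightarrow> F m \<subseteq> F n"
    and filtration_exhausts: "(\<Union>n. F n) = carrier B"
    and filtration_mult: "\<lbrakk>x \<in> F n; y \<in> F m\<rbrakk> \<Longrightarrow> x \<otimes>\<^bsub>B\<^esub> y \<in> F (n + m)"

definition left_ideal :: "'b set \<Rightarrow> ('b, 'w) ring_scheme \<Rightarrow> bool" where
  "left_ideal I B \<longleftrightarrow> additive_subgroup I B \<and> (\<forall>b\<in>carrier B. \<forall>x\<in>I. b \<otimes>\<^bsub>B\<^esub> x \<in> I)"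

definition left_ideal_span :: "('b, 'w) ring_scheme \<Rightarrow> 'b set \<Rightarrow> 'b set" where
  "left_ideal_span B A = \<Inter>{J. left_ideal J B \<and> A \<subseteq> J}"

locale filtered_noetherian = filtered_algebra +
  assumes filtered_noetherian:
    "left_ideal I B \<Longrightarrow>
       \<exists>(n::nat) x (l::nat). x ` {..<n} \<subseteq> I \<and> left_ideal_span B (x ` {..<n}) = I \<and>
         (\<forall>m. \<forall>y\<in>F m \<inter> I. \<exists>a.
            (\<forall>i<n. a i \<in> F (m + l)) \<and> y = (\<Oplus>\<^bsub>B\<^esub>i\<in>{..<n}. a i \<otimes>\<^bsub>B\<^esub> x i))"

end

theory Submission
  imports Defs
begin

text \<open>
  On \<open>\<Omega>\<^sup>2(R) \<oplus> \<Omega>\<^sup>1(R)\<close>, the right action \<open>(\<eta>, \<omega>) a = (\<eta> a + \<omega> da, \<omega> a)\<close> defines a bimodule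
  extension of \<open>\<Omega>\<^sup>1(R)\<close>. It splits because \<open>R\<close> is quasi-free, and a splitting is a connection.

  Every connection \<open>\<nabla>\<close> has finite degree on a bounded submodule \<open>M\<close> that contains algebra
  generators of \<open>R\<close>: as \<open>M\<close> is finitely generated, the forms \<open>\<nabla>(dm)\<close> for \<open>m\<close> in \<open>M\<close> all lie in one
  step of the filtration, and \<open>\<nabla>(d(mw)) = \<nabla>(dm) w + dm dw + m \<nabla>(dw)\<close> bounds the degree of
  \<open>\<nabla>(dw)\<close> by induction on the length of the word \<open>w\<close>.
\<close>

section \<open>Spans and linear maps\<close>

text \<open>The right action on the extension is chosen so that a map
  \<open>\<omega> \<mapsto> (nabla \<omega>, \<omega>)\<close> commutes with right multiplication
  exactly when \<open>nabla\<close> satisfies the Leibniz rule of a connection. To split the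
  extension, the identity of \<open>Omega1 V R\<close> is lifted. The obstacle is that
  \<open>projective_bimodule\<close> only tests bimodules whose elements have one particular
  function type: the extension has to be replaced by an isomorphic copy there, which needs an
  injection of its carrier.

  In the degree bound, the additive constant must not grow with the length of the word. This works
  because multiplication by an element of degree \<open>i\<close>, on either side, raises the
  filtration of 2-forms by at most \<open>i\<close>, and \<open>dm dw\<close> has degree at most one
  more than the length of \<open>w\<close>. Algebra generators are put into \<open>M\<close> so that
  the filtration of 2-forms is exhaustive and every single \<open>nabla (dg)\<close> has some
  degree. An identity of \<open>R\<close> is put there too: \<open>generates\<close> counts it as
  the empty product, whereas the powers of \<open>M\<close> start with words of length one.\<close>

lemma (in abelian_group) minus_eq_zero_iff:
  assumes "x \<in> carrier G" "y \<in> carrier G"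
  shows "x \<ominus> y = \<zero> \<longleftrightarrow> x = y"
proof
  assume "x \<ominus> y = \<zero>"
  then have "(x \<ominus> y) \<oplus> y = y" using assms by simp
  then show "x = y" using assms by (simp add: a_minus_def a_assoc l_neg)
qed (use assms in \<open>simp add: a_minus_def r_neg\<close>)

context module
begin

lemma submodule_span_superset: "A \<subseteq> submodule_span R M A"
  by (auto simp: submodule_span_def)

lemma submodule_span_least:
  "submodule N R M \<Longrightarrow> A \<subseteq> N \<Longrightarrow> submodule_span R M A \<subseteq> N"
  by (auto simp: submodule_span_def)

lemma submodule_span_subset_carrier:
  "A \<subseteq> carrier M \<Longrightarrow> submodule_span R M A \<subseteq> carrier M"
  by (rule submodule_span_least[OF carrier_is_submodule])

lemma submodule_span_mono: "A \<subseteq> B \<Longrightarrow> submodule_span R M A \<subseteq> submodule_span R M B"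
  by (auto simp: submodule_span_def)

lemma zero_in_submodule: "submodule N R M \<Longrightarrow> \<zero>\<^bsub>M\<^esub> \<in> N"
  using subgroup.one_closed[OF submodule.axioms(1)] by fastforce

lemma minus_in_submodule: "submodule N R M \<Longrightarrow> x \<in> N \<Longrightarrow> y \<in> N \<Longrightarrow> x \<ominus>\<^bsub>M\<^esub> y \<in> N"
  unfolding a_minus_def by (simp add: submoduleE)

lemma submodule_span_is_submodule:
  assumes "A \<subseteq> carrier M"
  shows "submodule (submodule_span R M A) R M"
proof (rule submoduleI)
  show "submodule_span R M A \<subseteq> carrier M"
    by (rule submodule_span_subset_carrier[OF assms])
qed (auto simp: submodule_span_def zero_in_submodule intro: submoduleE)

end

lemma linear_maps_closed: "f \<in> linear_maps V M N \<Longrightarrow> x \<in> carrier M \<Longrightarrow> f x \<in> carrier N"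
  by (auto simp: linear_maps_def)

lemma linear_maps_add:
  "f \<in> linear_maps V M N \<Longrightarrow> x \<in> carrier M \<Longrightarrow> y \<in> carrier M \<Longrightarrow> f (x \<oplus>\<^bsub>M\<^esub> y) = f x \<oplus>\<^bsub>N\<^esub> f y"
  by (auto simp: linear_maps_def)

lemma linear_maps_smult:
  "f \<in> linear_maps V M N \<Longrightarrow> c \<in> carrier V \<Longrightarrow> x \<in> carrier M \<Longrightarrow> f (c \<odot>\<^bsub>M\<^esub> x) = c \<odot>\<^bsub>N\<^esub> f x"
  by (auto simp: linear_maps_def)

lemma linear_mapsI:
  assumes "\<And>x. x \<in> carrier M \<Longrightarrow> f x \<in> carrier N"
    and "\<And>x y. x \<in> carrier M \<Longrightarrow> y \<in> carrier M \<Longrightarrow> f (x \<oplus>\<^bsub>M\<^esub> y) = f x \<oplus>\<^bsub>N\<^esub> f y"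
    and "\<And>c x. c \<in> carrier V \<Longrightarrow> x \<in> carrier M \<Longrightarrow> f (c \<odot>\<^bsub>M\<^esub> x) = c \<odot>\<^bsub>N\<^esub> f x"
  shows "f \<in> linear_maps V M N"
  using assms by (auto simp: linear_maps_def)

lemma linear_maps_comp:
  "f \<in> linear_maps V M N \<Longrightarrow> g \<in> linear_maps V N P \<Longrightarrow> (\<lambda>x. g (f x)) \<in> linear_maps V M P"
  by (auto simp: linear_maps_def Pi_iff)

text \<open>Serves two purposes: linear maps from \<open>M\<close> to \<open>N\<close>, and further
  below the tensor product of \<open>M\<close> and \<open>N\<close>.\<close>

locale two_modules = M: module V M + N: module V N
  for V :: "('v, 'z) ring_scheme" and M :: "('v, 'm, 'y) module_scheme"
    and N :: "('v, 'n, 'w) module_scheme"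
begin

lemma linear_maps_sum:
  assumes f: "f \<in> linear_maps V M N" and g: "g \<in> linear_maps V M N"
  shows "(\<lambda>x. f x \<oplus>\<^bsub>N\<^esub> g x) \<in> linear_maps V M N"
  by (rule linear_mapsI)
    (simp_all add: linear_maps_closed[OF f] linear_maps_closed[OF g] linear_maps_add[OF f]
      linear_maps_add[OF g] linear_maps_smult[OF f] linear_maps_smult[OF g] N.a_ac N.smult_r_distr)

lemma linear_maps_scale:
  assumes f: "f \<in> linear_maps V M N" and c: "c \<in> carrier V"
  shows "(\<lambda>x. c \<odot>\<^bsub>N\<^esub> f x) \<in> linear_maps V M N"
  by (rule linear_mapsI)
    (simp_all add: c linear_maps_closed[OF f] linear_maps_add[OF f] linear_maps_smult[OF f]
      N.smult_r_distr N.smult_assoc1[symmetric] M.R.m_comm)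

lemma linear_maps_zero:
  assumes f: "f \<in> linear_maps V M N"
  shows "f \<zero>\<^bsub>M\<^esub> = \<zero>\<^bsub>N\<^esub>"
proof -
  have "f (\<zero>\<^bsub>V\<^esub> \<odot>\<^bsub>M\<^esub> \<zero>\<^bsub>M\<^esub>) = \<zero>\<^bsub>V\<^esub> \<odot>\<^bsub>N\<^esub> f \<zero>\<^bsub>M\<^esub>"
    by (simp only: linear_maps_smult[OF f] M.R.zero_closed M.zero_closed)
  then show ?thesis by (simp add: linear_maps_closed[OF f])
qed

lemma linear_maps_neg:
  assumes f: "f \<in> linear_maps V M N" and x: "x \<in> carrier M"
  shows "f (\<ominus>\<^bsub>M\<^esub> x) = \<ominus>\<^bsub>N\<^esub> f x"
proof -
  have "f (\<ominus>\<^bsub>M\<^esub> x) \<oplus>\<^bsub>N\<^esub> f x = \<zero>\<^bsub>N\<^esub>"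
    using linear_maps_add[OF f, of "\<ominus>\<^bsub>M\<^esub> x" x] x by (simp add: M.l_neg linear_maps_zero[OF f])
  then show ?thesis using x by (simp add: N.minus_equality linear_maps_closed[OF f])
qed

lemma linear_maps_minus:
  assumes f: "f \<in> linear_maps V M N" and x: "x \<in> carrier M" "y \<in> carrier M"
  shows "f (x \<ominus>\<^bsub>M\<^esub> y) = f x \<ominus>\<^bsub>N\<^esub> f y"
  using x by (simp add: a_minus_def linear_maps_add[OF f] linear_maps_neg[OF f])

lemma linear_maps_diff:
  assumes f: "f \<in> linear_maps V M N" and g: "g \<in> linear_maps V M N"
  shows "(\<lambda>x. f x \<ominus>\<^bsub>N\<^esub> g x) \<in> linear_maps V M N"
proof -
  have "(\<lambda>x. f x \<oplus>\<^bsub>N\<^esub> (\<ominus>\<^bsub>V\<^esub> \<one>\<^bsub>V\<^esub>) \<odot>\<^bsub>N\<^esub> g x) \<in> linear_maps V M N"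
    by (intro linear_maps_sum linear_maps_scale f g) simp
  moreover have "f x \<oplus>\<^bsub>N\<^esub> (\<ominus>\<^bsub>V\<^esub> \<one>\<^bsub>V\<^esub>) \<odot>\<^bsub>N\<^esub> g x = f x \<ominus>\<^bsub>N\<^esub> g x" if "x \<in> carrier M" for x
    using that by (simp add: linear_maps_closed[OF g] N.smult_l_minus a_minus_def)
  \<comment> \<open>The two functions may differ outside the carrier, but membership in
    \<open>linear_maps\<close> only depends on the values on it.\<close>
  ultimately show ?thesis by (simp add: linear_maps_def Pi_iff)
qed

text \<open>Makes the set of all \<open>x\<close> with \<open>f x \<in> N'\<close> a submodule, so
  that such a membership only has to be checked on generators. Most of the later reductions to
  generators rest on this.\<close>

lemma submodule_vimage:
  assumes f: "f \<in> linear_maps V M N" and N': "submodule N' V N"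
  shows "submodule {x \<in> carrier M. f x \<in> N'} V M"
  by (rule M.submoduleI)
    (auto simp: linear_maps_zero[OF f] linear_maps_neg[OF f] linear_maps_add[OF f]
      linear_maps_smult[OF f] N.zero_in_submodule[OF N'] intro: N.submoduleE[OF N'])

lemma linear_maps_span:
  assumes f: "f \<in> linear_maps V M N" and N': "submodule N' V N"
    and A: "A \<subseteq> carrier M" "f ` A \<subseteq> N'"
  shows "f ` submodule_span V M A \<subseteq> N'"
  using M.submodule_span_least[OF submodule_vimage[OF f N'], of A] A by auto

end

text \<open>\<open>Q\<close> is only a record at first. Every module axiom is an equation or a
  closure condition, or asks for an inverse, and all of these pass along a surjection that respects
  the operations. This yields quotient modules and copies of a module in another record or another
  type.\<close>

lemma module_image:
  assumes "module V M" and surj: "p ` carrier M = carrier Q"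
    and add: "\<And>x y. x \<in> carrier M \<Longrightarrow> y \<in> carrier M \<Longrightarrow> p (x \<oplus>\<^bsub>M\<^esub> y) = p x \<oplus>\<^bsub>Q\<^esub> p y"
    and smult: "\<And>c x. c \<in> carrier V \<Longrightarrow> x \<in> carrier M \<Longrightarrow> p (c \<odot>\<^bsub>M\<^esub> x) = c \<odot>\<^bsub>Q\<^esub> p x"
    and zero: "p \<zero>\<^bsub>M\<^esub> = \<zero>\<^bsub>Q\<^esub>"
  shows "module V Q"
proof -
  interpret M: module V M by fact
  note ops = add[symmetric] smult[symmetric] zero[symmetric]
  show ?thesis
  proof (rule moduleI)
    show "abelian_group Q"
    proof (rule abelian_groupI)
      show "\<exists>y\<in>carrier Q. y \<oplus>\<^bsub>Q\<^esub> x = \<zero>\<^bsub>Q\<^esub>" if "x \<in> carrier Q" for x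
      proof -
        from that obtain x' where "x' \<in> carrier M" "x = p x'" by (auto simp flip: surj)
        then show ?thesis
          by (intro bexI[of _ "p (\<ominus>\<^bsub>M\<^esub> x')"]) (auto simp flip: surj simp: ops M.l_neg)
      qed
    qed (auto simp flip: surj simp: ops M.a_ac)
  qed (auto simp flip: surj simp: ops M.smult_l_distr M.smult_r_distr M.smult_assoc1 M.R.is_cring)
qed

section \<open>Tensor products\<close>

context module
begin

lemma quotient_module:
  assumes N: "submodule N R M"
  shows "(\<lambda>x. N +>\<^bsub>M\<^esub> x) \<in> linear_maps R M (quotient_module M N)" (is "?p \<in> _")
    and "module R (quotient_module M N)"
proof -
  have sub: "additive_subgroup N M"
    by (rule additive_subgroupI[OF submodule.axioms(1)[OF N]])
  interpret N: abelian_subgroup N M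
    by (rule abelian_subgroupI3[OF sub M.abelian_group_axioms])
  have surj: "?p ` carrier M = carrier (quotient_module M N)"
    by (auto simp: quotient_module_def A_RCOSETS_def')
  have add: "?p (x \<oplus>\<^bsub>M\<^esub> y) = ?p x \<oplus>\<^bsub>quotient_module M N\<^esub> ?p y"
    if "x \<in> carrier M" "y \<in> carrier M" for x y
    using that by (simp add: quotient_module_def N.a_rcos_sum)
  have smult: "?p (c \<odot>\<^bsub>M\<^esub> x) = c \<odot>\<^bsub>quotient_module M N\<^esub> ?p x"
    if c: "c \<in> carrier R" and x: "x \<in> carrier M" for c x
  proof -
    \<comment> \<open>Scalar multiplication in the quotient is a union over all representatives of a
      coset. It is a single coset because all of its members coincide.\<close>
    have eq: "?p (c \<odot>\<^bsub>M\<^esub> z) = ?p (c \<odot>\<^bsub>M\<^esub> x)" if "z \<in> ?p x" for z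
    proof -
      from that obtain h where h: "h \<in> N" "z = h \<oplus>\<^bsub>M\<^esub> x" by (auto simp: a_r_coset_def')
      have "h \<in> carrier M" using h(1) N.a_subset by auto
      then have "c \<odot>\<^bsub>M\<^esub> z = c \<odot>\<^bsub>M\<^esub> h \<oplus>\<^bsub>M\<^esub> c \<odot>\<^bsub>M\<^esub> x"
        using c x h by (simp add: smult_r_distr)
      moreover have "c \<odot>\<^bsub>M\<^esub> h \<in> N" using submoduleE(4)[OF N] c h by auto
      ultimately have "c \<odot>\<^bsub>M\<^esub> z \<in> ?p (c \<odot>\<^bsub>M\<^esub> x)" by (auto simp: a_r_coset_def')
      then show ?thesis
        using a_repr_independence[OF _ _ N.a_subgroup] c x by blast
    qed
    have "c \<odot>\<^bsub>quotient_module M N\<^esub> ?p x = (\<Union>z\<in>?p x. ?p (c \<odot>\<^bsub>M\<^esub> z))"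
      by (simp add: quotient_module_def)
    also have "\<dots> = ?p (c \<odot>\<^bsub>M\<^esub> x)"
      using eq N.a_rcos_self[OF x] by blast
    finally show ?thesis by simp
  qed
  show "?p \<in> linear_maps R M (quotient_module M N)"
    using surj by (auto intro!: linear_mapsI add smult)
  show "module R (quotient_module M N)"
  proof (rule module_image[OF module_axioms surj add smult])
    show "?p \<zero>\<^bsub>M\<^esub> = \<zero>\<^bsub>quotient_module M N\<^esub>"
      using N.a_subset by (simp add: quotient_module_def)
  qed
qed

lemma free_module_is_module: "module R (free_module R B)"
proof (rule moduleI)
  have fin: "finite {b. f b \<oplus> g b \<noteq> \<zero>}"
    if "finite {b. f b \<noteq> \<zero>}" "finite {b. g b \<noteq> \<zero>}" for f g :: "'e \<Rightarrow> 'a"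
    by (rule finite_subset[OF _ finite_UnI[OF that]]) auto
  show "abelian_group (free_module R B)"
  proof (rule abelian_groupI)
    fix f assume f: "f \<in> carrier (free_module R B)"
    have c: "f b \<in> carrier R" for b
      using f by (cases "b \<in> B") (auto simp: free_module_def)
    have "{b. \<ominus> f b \<noteq> \<zero>} \<subseteq> {b. f b \<noteq> \<zero>}" by auto
    then have "finite {b. \<ominus> f b \<noteq> \<zero>}"
      using f finite_subset by (fastforce simp: free_module_def)
    then show "\<exists>g\<in>carrier (free_module R B). g \<oplus>\<^bsub>free_module R B\<^esub> f = \<zero>\<^bsub>free_module R B\<^esub>"
      using f c by (intro bexI[of _ "\<lambda>b. \<ominus> f b"]) (auto simp: free_module_def R.l_neg)
  next
    fix f g h
    assume "f \<in> carrier (free_module R B)" "g \<in> carrier (free_module R B)"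
      "h \<in> carrier (free_module R B)"
    then have "f b \<in> carrier R" "g b \<in> carrier R" "h b \<in> carrier R" for b
      by (cases "b \<in> B"; auto simp: free_module_def)+
    then show "f \<oplus>\<^bsub>free_module R B\<^esub> g \<oplus>\<^bsub>free_module R B\<^esub> h
        = f \<oplus>\<^bsub>free_module R B\<^esub> (g \<oplus>\<^bsub>free_module R B\<^esub> h)"
      by (simp add: free_module_def R.a_assoc)
  next
    fix f g
    assume "f \<in> carrier (free_module R B)" "g \<in> carrier (free_module R B)"
    then have "f b \<in> carrier R" "g b \<in> carrier R" for b
      by (cases "b \<in> B"; auto simp: free_module_def)+
    then show "f \<oplus>\<^bsub>free_module R B\<^esub> g = g \<oplus>\<^bsub>free_module R B\<^esub> f"
      by (simp add: free_module_def R.a_comm)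
  next
    fix f assume "f \<in> carrier (free_module R B)"
    then have "f b \<in> carrier R" for b
      by (cases "b \<in> B"; auto simp: free_module_def)
    then show "\<zero>\<^bsub>free_module R B\<^esub> \<oplus>\<^bsub>free_module R B\<^esub> f = f"
      by (simp add: free_module_def)
  qed (auto simp: free_module_def fin)
next
  fix c f assume c: "c \<in> carrier R" and f: "f \<in> carrier (free_module R B)"
  have "{b. c \<otimes> f b \<noteq> \<zero>} \<subseteq> {b. f b \<noteq> \<zero>}" using c by auto
  then have "finite {b. c \<otimes> f b \<noteq> \<zero>}"
    using f finite_subset by (fastforce simp: free_module_def)
  then show "c \<odot>\<^bsub>free_module R B\<^esub> f \<in> carrier (free_module R B)"
    using c f by (auto simp: free_module_def)
next
  fix c d f
  assume c: "c \<in> carrier R" "d \<in> carrier R" and "f \<in> carrier (free_module R B)"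
  then have "f b \<in> carrier R" for b
    by (cases "b \<in> B"; auto simp: free_module_def)
  with c show "(c \<oplus> d) \<odot>\<^bsub>free_module R B\<^esub> f
      = c \<odot>\<^bsub>free_module R B\<^esub> f \<oplus>\<^bsub>free_module R B\<^esub> d \<odot>\<^bsub>free_module R B\<^esub> f"
    and "(c \<otimes> d) \<odot>\<^bsub>free_module R B\<^esub> f = c \<odot>\<^bsub>free_module R B\<^esub> (d \<odot>\<^bsub>free_module R B\<^esub> f)"
    by (simp_all add: free_module_def R.l_distr R.m_assoc)
next
  fix c f g
  assume c: "c \<in> carrier R"
    and "f \<in> carrier (free_module R B)" "g \<in> carrier (free_module R B)"
  then have "f b \<in> carrier R" "g b \<in> carrier R" for b
    by (cases "b \<in> B"; auto simp: free_module_def)+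
  with c show "c \<odot>\<^bsub>free_module R B\<^esub> (f \<oplus>\<^bsub>free_module R B\<^esub> g)
      = c \<odot>\<^bsub>free_module R B\<^esub> f \<oplus>\<^bsub>free_module R B\<^esub> c \<odot>\<^bsub>free_module R B\<^esub> g"
    by (simp add: free_module_def R.r_distr)
next
  fix f assume "f \<in> carrier (free_module R B)"
  then have "f b \<in> carrier R" for b
    by (cases "b \<in> B"; auto simp: free_module_def)
  then show "\<one> \<odot>\<^bsub>free_module R B\<^esub> f = f"
    by (simp add: free_module_def)
qed (rule R.is_cring)

end

lemma (in module) basis_vector_closed: "b \<in> B \<Longrightarrow> basis_vector R b \<in> carrier (free_module R B)"
  by (auto simp: free_module_def basis_vector_def)

text \<open>Induction on a finite set containing the support: one coordinate is set to zero and
  added back as a multiple of a basis vector.\<close>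

lemma (in module) basis_vector_induct:
  assumes N: "submodule N R (free_module R B)"
    and basis: "\<And>b. b \<in> B \<Longrightarrow> basis_vector R b \<in> N"
  shows "carrier (free_module R B) \<subseteq> N"
proof
  interpret F: module R "free_module R B" by (rule free_module_is_module)
  have "\<forall>f\<in>carrier (free_module R B). {b. f b \<noteq> \<zero>} \<subseteq> A \<longrightarrow> f \<in> N" if "finite A" for A
    using that
  proof (induction A)
    case empty
    have "(\<lambda>_. \<zero>) \<in> N"
      using F.zero_in_submodule[OF N] by (simp add: free_module_def)
    moreover have "f = (\<lambda>_. \<zero>)" if "{b. f b \<noteq> \<zero>} \<subseteq> {}" for f :: "'c \<Rightarrow> 'a"
      using that by auto
    ultimately show ?case by fastforce
  next
    case (insert a A)
    show ?case
    proof (intro ballI impI)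
      fix f assume f: "f \<in> carrier (free_module R B)" and supp: "{b. f b \<noteq> \<zero>} \<subseteq> insert a A"
      have c: "f b \<in> carrier R" for b
        using f by (cases "b \<in> B") (auto simp: free_module_def)
      show "f \<in> N"
      proof (cases "a \<in> B")
        case True
        have "finite {b. f b \<noteq> \<zero>}" using f by (simp add: free_module_def)
        then have "finite {b. (f(a := \<zero>)) b \<noteq> \<zero>}"
          by (rule rev_finite_subset) auto
        then have "f(a := \<zero>) \<in> carrier (free_module R B)"
          using f by (auto simp: free_module_def)
        moreover have "{b. (f(a := \<zero>)) b \<noteq> \<zero>} \<subseteq> A" using supp by auto
        ultimately have "f(a := \<zero>) \<in> N" using insert.IH by blast
        then have "f(a := \<zero>) \<oplus>\<^bsub>free_module R B\<^esub> f a \<odot>\<^bsub>free_module R B\<^esub> basis_vector R a \<in> N"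
          by (rule F.submoduleE(5)[OF N _ F.submoduleE(4)[OF N c basis[OF True]]])
        moreover have "f = f(a := \<zero>) \<oplus>\<^bsub>free_module R B\<^esub> f a \<odot>\<^bsub>free_module R B\<^esub> basis_vector R a"
          using c by (auto simp: free_module_def basis_vector_def)
        ultimately show ?thesis
          by metis
      next
        \<comment> \<open>A function in the carrier vanishes outside \<open>B\<close>, so
          \<open>a\<close> is not in the support.\<close>
        case False
        then have "{b. f b \<noteq> \<zero>} \<subseteq> A" using f supp by (auto simp: free_module_def)
        then show ?thesis using insert.IH f by blast
      qed
    qed
  qed
  then show "f \<in> N" if "f \<in> carrier (free_module R B)" for f
    using that by (auto simp: free_module_def)
qed

text \<open>The sum over the support is the formula that \<open>tensor_lift\<close> evaluates on
  representatives.\<close>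

lemma (in module) free_module_lift:
  assumes g: "g \<in> B \<rightarrow> carrier M"
  defines "\<phi> \<equiv> \<lambda>f. \<Oplus>\<^bsub>M\<^esub>b\<in>{b. f b \<noteq> \<zero>}. f b \<odot>\<^bsub>M\<^esub> g b"
  shows "\<phi> \<in> linear_maps R (free_module R B) M"
    and "b \<in> B \<Longrightarrow> \<phi> (basis_vector R b) = g b"
proof -
  let ?F = "free_module R B"
  have c: "f b \<in> carrier R" if "f \<in> carrier ?F" for f b
    using that by (cases "b \<in> B") (auto simp: free_module_def)
  have supp: "finite {b. f b \<noteq> \<zero>}" "{b. f b \<noteq> \<zero>} \<subseteq> B" if "f \<in> carrier ?F" for f
    using that by (auto simp: free_module_def)
  have fg: "(\<lambda>b. f b \<odot>\<^bsub>M\<^esub> g b) \<in> A \<rightarrow> carrier M" if "f \<in> carrier ?F" "A \<subseteq> B" for f A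
    using that g c by (auto simp: Pi_iff)
  \<comment> \<open>Additivity compares sums over different supports. Enlarging the index set to any
    finite set \<open>A\<close> that contains the support puts them over a common one.\<close>
  have phi: "\<phi> f = (\<Oplus>\<^bsub>M\<^esub>b\<in>A. f b \<odot>\<^bsub>M\<^esub> g b)"
    if "f \<in> carrier ?F" "finite A" "A \<subseteq> B" "{b. f b \<noteq> \<zero>} \<subseteq> A" for f A
    unfolding \<phi>_def using that g
    by (intro M.add.finprod_mono_neutral_cong_left fg) (auto simp: Pi_iff)
  interpret F: module R ?F by (rule free_module_is_module)
  show "\<phi> \<in> linear_maps R ?F M"
  proof (rule linear_mapsI)
    fix f assume f: "f \<in> carrier ?F"
    show "\<phi> f \<in> carrier M"
      unfolding \<phi>_def by (rule M.finsum_closed[OF fg[OF f supp(2)[OF f]]])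
  next
    fix f h assume f: "f \<in> carrier ?F" and h: "h \<in> carrier ?F"
    let ?A = "{b. f b \<noteq> \<zero>} \<union> {b. h b \<noteq> \<zero>}"
    have A: "finite ?A" "?A \<subseteq> B" using supp[OF f] supp[OF h] by auto
    have sum: "(f \<oplus>\<^bsub>?F\<^esub> h) b = f b \<oplus> h b" for b by (simp add: free_module_def)
    have "\<phi> (f \<oplus>\<^bsub>?F\<^esub> h) = (\<Oplus>\<^bsub>M\<^esub>b\<in>?A. (f \<oplus>\<^bsub>?F\<^esub> h) b \<odot>\<^bsub>M\<^esub> g b)"
      by (rule phi) (use A f h sum in auto)
    also have "\<dots> = (\<Oplus>\<^bsub>M\<^esub>b\<in>?A. f b \<odot>\<^bsub>M\<^esub> g b \<oplus>\<^bsub>M\<^esub> h b \<odot>\<^bsub>M\<^esub> g b)"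
    proof (rule M.finsum_cong'[OF refl])
      show "(f \<oplus>\<^bsub>?F\<^esub> h) b \<odot>\<^bsub>M\<^esub> g b = f b \<odot>\<^bsub>M\<^esub> g b \<oplus>\<^bsub>M\<^esub> h b \<odot>\<^bsub>M\<^esub> g b" if "b \<in> ?A" for b
      proof -
        have "g b \<in> carrier M" using that A(2) g by blast
        then show ?thesis by (simp only: sum smult_l_distr c[OF f] c[OF h])
      qed
    qed (use fg[OF f A(2)] fg[OF h A(2)] in auto)
    also have "\<dots> = (\<Oplus>\<^bsub>M\<^esub>b\<in>?A. f b \<odot>\<^bsub>M\<^esub> g b) \<oplus>\<^bsub>M\<^esub> (\<Oplus>\<^bsub>M\<^esub>b\<in>?A. h b \<odot>\<^bsub>M\<^esub> g b)"
      by (rule M.finsum_addf) (rule fg[OF f A(2)] fg[OF h A(2)])+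
    also have "\<dots> = \<phi> f \<oplus>\<^bsub>M\<^esub> \<phi> h"
      using phi[OF f A] phi[OF h A] by auto
    finally show "\<phi> (f \<oplus>\<^bsub>?F\<^esub> h) = \<phi> f \<oplus>\<^bsub>M\<^esub> \<phi> h" .
  next
    fix a f assume a: "a \<in> carrier R" and f: "f \<in> carrier ?F"
    let ?A = "{b. f b \<noteq> \<zero>}"
    have A: "finite ?A" "?A \<subseteq> B" by (rule supp[OF f])+
    have scale: "(a \<odot>\<^bsub>?F\<^esub> f) b = a \<otimes> f b" for b by (simp add: free_module_def)
    have "\<phi> (a \<odot>\<^bsub>?F\<^esub> f) = (\<Oplus>\<^bsub>M\<^esub>b\<in>?A. (a \<odot>\<^bsub>?F\<^esub> f) b \<odot>\<^bsub>M\<^esub> g b)"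
      by (rule phi) (use A a f scale in auto)
    also have "\<dots> = (\<Oplus>\<^bsub>M\<^esub>b\<in>?A. a \<odot>\<^bsub>M\<^esub> (f b \<odot>\<^bsub>M\<^esub> g b))"
    proof (rule M.finsum_cong'[OF refl])
      show "(a \<odot>\<^bsub>?F\<^esub> f) b \<odot>\<^bsub>M\<^esub> g b = a \<odot>\<^bsub>M\<^esub> (f b \<odot>\<^bsub>M\<^esub> g b)" if "b \<in> ?A" for b
      proof -
        have "g b \<in> carrier M" using that A(2) g by blast
        then show ?thesis by (simp only: scale smult_assoc1 a c[OF f])
      qed
    qed (use fg[OF f A(2)] a in auto)
    also have "\<dots> = a \<odot>\<^bsub>M\<^esub> \<phi> f"
      unfolding \<phi>_def by (rule finsum_smult_ldistr[symmetric, OF A(1) a fg[OF f A(2)]])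
    finally show "\<phi> (a \<odot>\<^bsub>?F\<^esub> f) = a \<odot>\<^bsub>M\<^esub> \<phi> f" .
  qed
  show "\<phi> (basis_vector R b) = g b" if b: "b \<in> B"
  proof -
    have gb: "g b \<in> carrier M" using b g by auto
    have "\<phi> (basis_vector R b) = (\<Oplus>\<^bsub>M\<^esub>b'\<in>{b}. basis_vector R b b' \<odot>\<^bsub>M\<^esub> g b')"
      by (rule phi) (use b in \<open>auto simp: basis_vector_closed\<close>, auto simp: basis_vector_def split: if_splits)
    then show ?thesis using gb by (simp add: basis_vector_def)
  qed
qed

section \<open>The universal property of the tensor product\<close>

definition bilinear_map ::
    "('v, 'z) ring_scheme \<Rightarrow> ('v, 'm, 'y) module_scheme \<Rightarrow> ('v, 'n, 'w) module_scheme
      \<Rightarrow> ('v, 'p, 'x) module_scheme \<Rightarrow> ('m \<Rightarrow> 'n \<Rightarrow> 'p) \<Rightarrow> bool" where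
  "bilinear_map V M N P \<beta> \<longleftrightarrow>
     (\<forall>x\<in>carrier M. (\<lambda>y. \<beta> x y) \<in> linear_maps V N P) \<and>
     (\<forall>y\<in>carrier N. (\<lambda>x. \<beta> x y) \<in> linear_maps V M P)"

context two_modules
begin

abbreviation "pairs \<equiv> free_module V (carrier M \<times> carrier N)"
abbreviation "kern \<equiv> tensor_kernel V M N"
abbreviation "proj \<equiv> \<lambda>f. kern +>\<^bsub>pairs\<^esub> f"

sublocale F: module V pairs
  by (rule M.free_module_is_module)

lemma tensor_relations_closed: "tensor_relations V M N \<subseteq> carrier pairs"
  by (auto simp: tensor_relations_def Let_def
      intro!: F.minus_closed F.a_closed F.smult_closed M.basis_vector_closed)

lemma tensor_kernel_submodule: "submodule kern V pairs"
  unfolding tensor_kernel_def by (rule F.submodule_span_is_submodule[OF tensor_relations_closed])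

sublocale T: module V "tensor V M N"
  unfolding tensor_def by (rule F.quotient_module(2)[OF tensor_kernel_submodule])

lemma proj_linear: "proj \<in> linear_maps V pairs (tensor V M N)"
  unfolding tensor_def by (rule F.quotient_module(1)[OF tensor_kernel_submodule])

lemma proj_surj: "t \<in> carrier (tensor V M N) \<Longrightarrow> \<exists>f\<in>carrier pairs. t = proj f"
  by (auto simp: tensor_def quotient_module_def A_RCOSETS_def')

lemma proj_relation:
  assumes "f \<in> tensor_relations V M N"
  shows "proj f = \<zero>\<^bsub>tensor V M N\<^esub>"
proof -
  have "f \<in> kern" unfolding tensor_kernel_def using assms F.submodule_span_superset by blast
  moreover have "f \<in> carrier pairs" using assms tensor_relations_closed by blast
  ultimately show ?thesis
    using F.a_coset_join2[OF _ submodule.axioms(1)[OF tensor_kernel_submodule]]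
    by (simp add: tensor_def quotient_module_def)
qed

text \<open>Each defining relation of the tensor product is written as a difference in the free
  module, so this turns it into an equation between tensors.\<close>

lemma proj_relation_eq:
  assumes "f \<ominus>\<^bsub>pairs\<^esub> g \<in> tensor_relations V M N" "f \<in> carrier pairs" "g \<in> carrier pairs"
  shows "proj f = proj g"
proof -
  interpret FT: two_modules V pairs "tensor V M N" ..
  have c: "proj f \<in> carrier (tensor V M N)" "proj g \<in> carrier (tensor V M N)"
    using assms by (auto intro: linear_maps_closed[OF proj_linear])
  have "proj f \<ominus>\<^bsub>tensor V M N\<^esub> proj g = \<zero>\<^bsub>tensor V M N\<^esub>"
    using FT.linear_maps_minus[OF proj_linear assms(2,3)] proj_relation[OF assms(1)] by simp
  then show ?thesis using c by (simp add: T.minus_eq_zero_iff)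
qed

lemma bilinear_pure_tensor: "bilinear_map V M N (tensor V M N) (pure_tensor V M N)"
proof -
  note defs = pure_tensor_def tensor_relations_def Let_def
  note closed = M.basis_vector_closed
  \<comment> \<open>In this direction, sums and scalars move inside \<open>proj\<close>. Both sides
    are then classes of functions, and each of the four families of relations gives one of the four
    laws through \<open>proj_relation_eq\<close>.\<close>
  note hom = linear_maps_add[OF proj_linear, symmetric] linear_maps_smult[OF proj_linear, symmetric]
  have "pure_tensor V M N (x \<oplus>\<^bsub>M\<^esub> x') y
      = pure_tensor V M N x y \<oplus>\<^bsub>tensor V M N\<^esub> pure_tensor V M N x' y"
    if "x \<in> carrier M" "x' \<in> carrier M" "y \<in> carrier N" for x x' y
    unfolding pure_tensor_def using that
    by (simp only: hom closed SigmaI) (rule proj_relation_eq; auto simp: defs intro: closed)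
  moreover have "pure_tensor V M N x (y \<oplus>\<^bsub>N\<^esub> y')
      = pure_tensor V M N x y \<oplus>\<^bsub>tensor V M N\<^esub> pure_tensor V M N x y'"
    if "x \<in> carrier M" "y \<in> carrier N" "y' \<in> carrier N" for x y y'
    unfolding pure_tensor_def using that
    by (simp only: hom closed SigmaI) (rule proj_relation_eq; auto simp: defs intro: closed)
  moreover have "pure_tensor V M N (c \<odot>\<^bsub>M\<^esub> x) y = c \<odot>\<^bsub>tensor V M N\<^esub> pure_tensor V M N x y"
    if "c \<in> carrier V" "x \<in> carrier M" "y \<in> carrier N" for c x y
    unfolding pure_tensor_def using that
    by (simp only: hom closed SigmaI) (rule proj_relation_eq; auto simp: defs intro: closed)
  moreover have "pure_tensor V M N x (c \<odot>\<^bsub>N\<^esub> y) = c \<odot>\<^bsub>tensor V M N\<^esub> pure_tensor V M N x y"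
    if "c \<in> carrier V" "x \<in> carrier M" "y \<in> carrier N" for c x y
    unfolding pure_tensor_def using that
    by (simp only: hom closed SigmaI) (rule proj_relation_eq; auto simp: defs intro: closed)
  moreover have "pure_tensor V M N x y \<in> carrier (tensor V M N)"
    if "x \<in> carrier M" "y \<in> carrier N" for x y
    unfolding pure_tensor_def using that by (auto intro: linear_maps_closed[OF proj_linear] closed)
  ultimately show ?thesis
    by (auto simp: bilinear_map_def intro!: linear_mapsI)
qed

text \<open>Fact 1 is linearity in the right factor, with the left one fixed; fact 2 is linearity in
  the left factor.\<close>

lemmas pure_tensor_linear =
  bspec[OF conjunct1[OF bilinear_pure_tensor[unfolded bilinear_map_def]]]
  bspec[OF conjunct2[OF bilinear_pure_tensor[unfolded bilinear_map_def]]]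

lemma pure_tensor_closed:
  "x \<in> carrier M \<Longrightarrow> y \<in> carrier N \<Longrightarrow> pure_tensor V M N x y \<in> carrier (tensor V M N)"
  by (rule linear_maps_closed[OF pure_tensor_linear(1)])

text \<open>The preimage of \<open>N'\<close> under \<open>proj\<close> is a submodule of the free
  module that contains the basis vectors, hence everything.\<close>

lemma tensor_span:
  assumes N': "submodule N' V (tensor V M N)"
    and pure: "\<And>x y. x \<in> carrier M \<Longrightarrow> y \<in> carrier N \<Longrightarrow> pure_tensor V M N x y \<in> N'"
  shows "carrier (tensor V M N) \<subseteq> N'"
proof -
  interpret FT: two_modules V pairs "tensor V M N" ..
  have "carrier pairs \<subseteq> {f \<in> carrier pairs. proj f \<in> N'}"
    by (rule M.basis_vector_induct[OF FT.submodule_vimage[OF proj_linear N']])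
      (use pure in \<open>auto simp: pure_tensor_def intro: M.basis_vector_closed\<close>)
  then show ?thesis using proj_surj by blast
qed

text \<open>The kernel of the difference of \<open>f\<close> and \<open>g\<close> is a submodule
  that contains all pure tensors. This is how identities between forms are reduced to forms
  \<open>\<omega> dy\<close>.\<close>

lemma tensor_maps_eq:
  assumes "module V P"
    and f: "f \<in> linear_maps V (tensor V M N) P" and g: "g \<in> linear_maps V (tensor V M N) P"
    and eq: "\<And>x y. x \<in> carrier M \<Longrightarrow> y \<in> carrier N
      \<Longrightarrow> f (pure_tensor V M N x y) = g (pure_tensor V M N x y)"
    and t: "t \<in> carrier (tensor V M N)"
  shows "f t = g t"
proof -
  interpret P: module V P by fact
  interpret TP: two_modules V "tensor V M N" P ..
  let ?h = "\<lambda>t. f t \<ominus>\<^bsub>P\<^esub> g t"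
  have "?h \<in> linear_maps V (tensor V M N) P" by (rule TP.linear_maps_diff[OF f g])
  moreover have "submodule {\<zero>\<^bsub>P\<^esub>} V P" by (rule P.submoduleI) auto
  ultimately have "submodule {t \<in> carrier (tensor V M N). ?h t \<in> {\<zero>\<^bsub>P\<^esub>}} V (tensor V M N)"
    by (rule TP.submodule_vimage)
  then have "carrier (tensor V M N) \<subseteq> {t \<in> carrier (tensor V M N). ?h t \<in> {\<zero>\<^bsub>P\<^esub>}}"
    by (rule tensor_span)
      (use eq in \<open>auto simp: P.minus_eq_zero_iff pure_tensor_closed linear_maps_closed[OF f] linear_maps_closed[OF g]\<close>)
  then show ?thesis
    using t by (auto simp: P.minus_eq_zero_iff linear_maps_closed[OF f] linear_maps_closed[OF g])
qed

text \<open>The \<open>the_elem\<close> in \<open>tensor_lift\<close> is meaningful only if all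
  representatives of a coset have the same image. The sum formula is linear on the free module and,
  by bilinearity of \<open>\<beta>\<close>, kills the relations; so it kills their span and is
  constant on cosets.\<close>

lemma
  assumes "module V P" and \<beta>: "bilinear_map V M N P \<beta>"
  shows tensor_lift_linear: "tensor_lift V P \<beta> \<in> linear_maps V (tensor V M N) P"
    and tensor_lift_pure: "\<And>x y. x \<in> carrier M \<Longrightarrow> y \<in> carrier N
      \<Longrightarrow> tensor_lift V P \<beta> (pure_tensor V M N x y) = \<beta> x y"
proof -
  interpret P: module V P by fact
  interpret FP: two_modules V pairs P ..
  have \<beta>1: "(\<lambda>y. \<beta> x y) \<in> linear_maps V N P" if "x \<in> carrier M" for x
    using \<beta> that by (auto simp: bilinear_map_def)
  have \<beta>2: "(\<lambda>x. \<beta> x y) \<in> linear_maps V M P" if "y \<in> carrier N" for y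
    using \<beta> that by (auto simp: bilinear_map_def)
  have \<beta>c: "\<beta> x y \<in> carrier P" if "x \<in> carrier M" "y \<in> carrier N" for x y
    using linear_maps_closed[OF \<beta>1] that by blast
  let ?g = "\<lambda>b. \<beta> (fst b) (snd b)"
  define \<phi> where "\<phi> f = (\<Oplus>\<^bsub>P\<^esub>b\<in>{b. f b \<noteq> \<zero>\<^bsub>V\<^esub>}. f b \<odot>\<^bsub>P\<^esub> ?g b)" for f
  have g: "?g \<in> carrier M \<times> carrier N \<rightarrow> carrier P" using \<beta>c by auto
  have \<phi>: "\<phi> \<in> linear_maps V pairs P" unfolding \<phi>_def by (rule P.free_module_lift(1)[OF g])
  have \<phi>b: "\<phi> (basis_vector V (x, y)) = \<beta> x y" if "x \<in> carrier M" "y \<in> carrier N" for x y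
    unfolding \<phi>_def using P.free_module_lift(2)[OF g, of "(x, y)"] that by simp
  note \<phi>_simps = FP.linear_maps_minus[OF \<phi>] linear_maps_add[OF \<phi>] linear_maps_smult[OF \<phi>]
    \<phi>b linear_maps_add[OF \<beta>1] linear_maps_add[OF \<beta>2] linear_maps_smult[OF \<beta>1] linear_maps_smult[OF \<beta>2]
  have "submodule {\<zero>\<^bsub>P\<^esub>} V P" by (rule P.submoduleI) auto
  moreover have "\<phi> ` tensor_relations V M N \<subseteq> {\<zero>\<^bsub>P\<^esub>}"
    by (auto simp: tensor_relations_def Let_def \<phi>_simps P.minus_eq_zero_iff M.basis_vector_closed \<beta>c)
  ultimately have "\<phi> ` kern \<subseteq> {\<zero>\<^bsub>P\<^esub>}"
    unfolding tensor_kernel_def by (rule FP.linear_maps_span[OF \<phi> _ tensor_relations_closed])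
  then have kern: "\<phi> k = \<zero>\<^bsub>P\<^esub>" if "k \<in> kern" for k using that by blast
  have kern_sub: "kern \<subseteq> carrier pairs" by (rule F.submoduleE(1)[OF tensor_kernel_submodule])
  have lift: "tensor_lift V P \<beta> (proj f) = \<phi> f" if f: "f \<in> carrier pairs" for f
  proof -
    have "\<phi> h = \<phi> f" if "h \<in> proj f" for h
    proof -
      from that obtain k where k: "k \<in> kern" "h = k \<oplus>\<^bsub>pairs\<^esub> f" by (auto simp: a_r_coset_def')
      then have "k \<in> carrier pairs" using kern_sub by blast
      then show ?thesis using k f by (simp add: linear_maps_add[OF \<phi>] kern linear_maps_closed[OF \<phi>])
    qed
    \<comment> \<open>Constancy alone would allow an empty image; a singleton also needs a
      representative.\<close>
    moreover have "proj f \<noteq> {}"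
      using F.zero_in_submodule[OF tensor_kernel_submodule] by (auto simp: a_r_coset_def')
    ultimately have "\<phi> ` proj f = {\<phi> f}" by auto
    then show ?thesis unfolding tensor_lift_def \<phi>_def by simp
  qed
  show "tensor_lift V P \<beta> (pure_tensor V M N x y) = \<beta> x y" if "x \<in> carrier M" "y \<in> carrier N" for x y
    using that by (simp add: pure_tensor_def lift M.basis_vector_closed \<phi>b)
  show "tensor_lift V P \<beta> \<in> linear_maps V (tensor V M N) P"
  proof (rule linear_mapsI)
    fix s assume "s \<in> carrier (tensor V M N)"
    then show "tensor_lift V P \<beta> s \<in> carrier P"
      using proj_surj lift linear_maps_closed[OF \<phi>] by metis
  next
    fix s t assume "s \<in> carrier (tensor V M N)" "t \<in> carrier (tensor V M N)"
    then obtain f g where f: "f \<in> carrier pairs" "s = proj f" and g: "g \<in> carrier pairs" "t = proj g"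
      using proj_surj by metis
    have "s \<oplus>\<^bsub>tensor V M N\<^esub> t = proj (f \<oplus>\<^bsub>pairs\<^esub> g)"
      using f g linear_maps_add[OF proj_linear] by simp
    then show "tensor_lift V P \<beta> (s \<oplus>\<^bsub>tensor V M N\<^esub> t) = tensor_lift V P \<beta> s \<oplus>\<^bsub>P\<^esub> tensor_lift V P \<beta> t"
      using f g by (simp add: lift linear_maps_add[OF \<phi>])
  next
    fix c s assume c: "c \<in> carrier V" and "s \<in> carrier (tensor V M N)"
    then obtain f where f: "f \<in> carrier pairs" "s = proj f"
      using proj_surj by metis
    have "c \<odot>\<^bsub>tensor V M N\<^esub> s = proj (c \<odot>\<^bsub>pairs\<^esub> f)"
      using c f linear_maps_smult[OF proj_linear] by simp
    then show "tensor_lift V P \<beta> (c \<odot>\<^bsub>tensor V M N\<^esub> s) = c \<odot>\<^bsub>P\<^esub> tensor_lift V P \<beta> s"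
      using c f by (simp add: lift linear_maps_smult[OF \<phi>])
  qed
qed

end

lemma (in abelian_group) add_minus_add:
  assumes "p \<in> carrier G" "q \<in> carrier G" "r \<in> carrier G" "s \<in> carrier G"
  shows "(p \<oplus> q) \<ominus> (r \<oplus> s) = (p \<ominus> r) \<oplus> (q \<ominus> s)"
  using assms by (simp add: a_minus_def minus_add a_ac)

text \<open>The cancellation behind the associativity of the right action on
  \<open>\<omega> dy\<close>, where \<open>p\<close>, \<open>q\<close>, \<open>r\<close> are
  \<open>\<omega> d(yab)\<close>, \<open>(\<omega> y a) db\<close> and
  \<open>(\<omega> y) d(ab)\<close>.\<close>

lemma (in abelian_group) minus_minus_minus:
  assumes "p \<in> carrier G" "q \<in> carrier G" "r \<in> carrier G"
  shows "(p \<ominus> q) \<ominus> (r \<ominus> q) = p \<ominus> r"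
  using assms by (simp add: a_minus_def minus_add a_ac r_neg l_neg r_neg1 r_neg2)

lemma (in module) smult_minus:
  assumes "c \<in> carrier R" "x \<in> carrier M" "y \<in> carrier M"
  shows "c \<odot>\<^bsub>M\<^esub> (x \<ominus>\<^bsub>M\<^esub> y) = c \<odot>\<^bsub>M\<^esub> x \<ominus>\<^bsub>M\<^esub> c \<odot>\<^bsub>M\<^esub> y"
  using assms by (simp add: a_minus_def smult_r_distr smult_r_minus)

section \<open>Bimodules of forms\<close>

sublocale bimodule \<subseteq> ER: two_modules V E R ..

lemma (in bimodule)
  shows lact_linear: "a \<in> carrier R \<Longrightarrow> lact E a \<in> linear_maps V E E"
    and ract_linear: "a \<in> carrier R \<Longrightarrow> (\<lambda>x. ract E x a) \<in> linear_maps V E E"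
    and ract_linear_scalar: "x \<in> carrier E \<Longrightarrow> ract E x \<in> linear_maps V R E"
  by (auto intro!: linear_mapsI lact_closed ract_closed lact_add_left lact_add_right lact_smult_left
      lact_smult_right ract_add_left ract_add_right ract_smult_left ract_smult_right)

lemma (in nonunital_algebra)
  shows mult_right_linear: "a \<in> carrier R \<Longrightarrow> (\<lambda>y. y \<otimes>\<^bsub>R\<^esub> a) \<in> linear_maps V R R"
    and mult_left_linear: "a \<in> carrier R \<Longrightarrow> (\<lambda>y. a \<otimes>\<^bsub>R\<^esub> y) \<in> linear_maps V R R"
  by (auto intro!: linear_mapsI mult_closed mult_add_left mult_add_right mult_smult_left mult_smult_right)

text \<open>\<open>forms_step\<close> only adds two actions to the tensor product, but it is a
  record of another type. These rules bring the module part back to \<open>tensor V E R\<close>. As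
  \<open>a_inv\<close> and \<open>a_minus\<close> are functions of the record and not fields, they
  need rules of their own.\<close>

lemma forms_step_simps [simp]:
  "carrier (forms_step V R E) = carrier (tensor V E R)"
  "add (forms_step V R E) = add (tensor V E R)"
  "ring.zero (forms_step V R E) = ring.zero (tensor V E R)"
  "smult (forms_step V R E) = smult (tensor V E R)"
  "a_inv (forms_step V R E) = a_inv (tensor V E R)"
  "a_minus (forms_step V R E) = a_minus (tensor V E R)"
  by (auto simp: forms_step_def Let_def bimodule.defs module.defs a_inv_def m_inv_def a_minus_def fun_eq_iff)

lemma linear_maps_forms_step [simp]:
  "linear_maps V (forms_step V R E) P = linear_maps V (tensor V E R) P"
  "linear_maps V Q (forms_step V R E) = linear_maps V Q (tensor V E R)"
  by (simp_all add: linear_maps_def)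

lemma submodule_forms_step [simp]:
  "submodule N V (forms_step V R E) \<longleftrightarrow> submodule N V (tensor V E R)"
  by (auto simp: submodule_def submodule_axioms_def subgroup_def m_inv_def)

context bimodule
begin

abbreviation "forms \<equiv> forms_step V R E"
abbreviation "dtensor \<equiv> pure_tensor V E R"

lemma forms_module: "module V forms"
  by (rule module_image[OF ER.T.module_axioms, of id]) auto

sublocale TT: two_modules V "tensor V E R" "tensor V E R" ..

text \<open>Bilinearity of the two formulas in \<open>forms_step\<close> is what makes the actions
  well defined and allows computing them on pure tensors.\<close>

lemma forms_lact_bilinear:
  assumes "a \<in> carrier R"
  shows "bilinear_map V E R (tensor V E R) (\<lambda>\<omega> y. dtensor (lact E a \<omega>) y)"
  unfolding bilinear_map_def using assms
  by (auto intro: ER.pure_tensor_linear(1) lact_closed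
      linear_maps_comp[OF lact_linear ER.pure_tensor_linear(2)])

lemma forms_ract_bilinear:
  assumes a: "a \<in> carrier R"
  shows "bilinear_map V E R (tensor V E R)
    (\<lambda>\<omega> y. dtensor \<omega> (y \<otimes>\<^bsub>R\<^esub> a) \<ominus>\<^bsub>tensor V E R\<^esub> dtensor (ract E \<omega> y) a)"
proof -
  interpret RT: two_modules V R "tensor V E R" ..
  interpret ET: two_modules V E "tensor V E R" ..
  show ?thesis
    unfolding bilinear_map_def using a
    by (auto intro!: RT.linear_maps_diff ET.linear_maps_diff ER.pure_tensor_linear(2) mult_closed
        linear_maps_comp[OF mult_right_linear ER.pure_tensor_linear(1)]
        linear_maps_comp[OF ract_linear ER.pure_tensor_linear(2)]
        linear_maps_comp[OF ract_linear_scalar ER.pure_tensor_linear(2)])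
qed

lemma forms_lact:
  "lact forms a t = tensor_lift V (tensor V E R) (\<lambda>\<omega> y. dtensor (lact E a \<omega>) y) t"
  by (simp add: forms_step_def Let_def bimodule.defs module.defs)

lemma forms_ract:
  "ract forms t a = tensor_lift V (tensor V E R)
    (\<lambda>\<omega> y. dtensor \<omega> (y \<otimes>\<^bsub>R\<^esub> a) \<ominus>\<^bsub>tensor V E R\<^esub> dtensor (ract E \<omega> y) a) t"
  by (simp add: forms_step_def Let_def bimodule.defs module.defs)

lemma forms_lact_linear:
  "a \<in> carrier R \<Longrightarrow> (\<lambda>t. lact forms a t) \<in> linear_maps V (tensor V E R) (tensor V E R)"
  unfolding forms_lact by (rule ER.tensor_lift_linear[OF ER.T.module_axioms forms_lact_bilinear])

lemma forms_ract_linear: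
  "a \<in> carrier R \<Longrightarrow> (\<lambda>t. ract forms t a) \<in> linear_maps V (tensor V E R) (tensor V E R)"
  unfolding forms_ract by (rule ER.tensor_lift_linear[OF ER.T.module_axioms forms_ract_bilinear])

lemma forms_lact_pure:
  "a \<in> carrier R \<Longrightarrow> \<omega> \<in> carrier E \<Longrightarrow> y \<in> carrier R
    \<Longrightarrow> lact forms a (dtensor \<omega> y) = dtensor (lact E a \<omega>) y"
  unfolding forms_lact by (rule ER.tensor_lift_pure[OF ER.T.module_axioms forms_lact_bilinear])

lemma forms_ract_pure:
  "a \<in> carrier R \<Longrightarrow> \<omega> \<in> carrier E \<Longrightarrow> y \<in> carrier R
    \<Longrightarrow> ract forms (dtensor \<omega> y) a
      = dtensor \<omega> (y \<otimes>\<^bsub>R\<^esub> a) \<ominus>\<^bsub>tensor V E R\<^esub> dtensor (ract E \<omega> y) a"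
  unfolding forms_ract by (rule ER.tensor_lift_pure[OF ER.T.module_axioms forms_ract_bilinear])

text \<open>Both sides of each axiom are linear in the form, so it suffices to compare them on
  \<open>\<omega> dy\<close>, where the actions are explicit.\<close>

lemma bimodule_forms_step: "bimodule V R forms"
proof -
  let ?T = "tensor V E R"
  note closed = lact_closed ract_closed mult_closed ER.pure_tensor_closed
    smult_closed a_closed
  note eqI = ER.tensor_maps_eq[OF ER.T.module_axioms]
  note pure = forms_lact_pure forms_ract_pure
  note add1 = linear_maps_add[OF ER.pure_tensor_linear(1)]
  note add2 = linear_maps_add[OF ER.pure_tensor_linear(2)]
  note smult1 = linear_maps_smult[OF ER.pure_tensor_linear(1)]
  note smult2 = linear_maps_smult[OF ER.pure_tensor_linear(2)]
  note linear = forms_lact_linear forms_ract_linear TT.linear_maps_sum TT.linear_maps_scale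
    linear_maps_comp[OF forms_lact_linear forms_lact_linear]
    linear_maps_comp[OF forms_ract_linear forms_ract_linear]
    linear_maps_comp[OF forms_ract_linear forms_lact_linear]
    linear_maps_comp[OF forms_lact_linear forms_ract_linear]
  have lact_plus: "lact forms (a \<oplus>\<^bsub>R\<^esub> b) t = lact forms a t \<oplus>\<^bsub>?T\<^esub> lact forms b t"
    if "a \<in> carrier R" "b \<in> carrier R" "t \<in> carrier ?T" for a b t
    by (rule eqI[OF _ _ _ that(3)])
      (use that in \<open>auto intro!: linear simp: pure closed lact_add_left add2\<close>)
  have lact_scale: "lact forms (c \<odot>\<^bsub>R\<^esub> a) t = c \<odot>\<^bsub>?T\<^esub> lact forms a t"
    if "c \<in> carrier V" "a \<in> carrier R" "t \<in> carrier ?T" for c a t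
    by (rule eqI[OF _ _ _ that(3)])
      (use that in \<open>auto intro!: linear simp: pure closed lact_smult_left smult2\<close>)
  have lact_mult: "lact forms (a \<otimes>\<^bsub>R\<^esub> b) t = lact forms a (lact forms b t)"
    if "a \<in> carrier R" "b \<in> carrier R" "t \<in> carrier ?T" for a b t
    by (rule eqI[OF _ _ _ that(3)])
      (use that in \<open>auto intro!: linear simp: pure closed lact_assoc\<close>)
  have ract_plus: "ract forms t (a \<oplus>\<^bsub>R\<^esub> b) = ract forms t a \<oplus>\<^bsub>?T\<^esub> ract forms t b"
    if "a \<in> carrier R" "b \<in> carrier R" "t \<in> carrier ?T" for a b t
    by (rule eqI[OF _ _ _ that(3)])
      (use that in \<open>auto intro!: linear simp: pure closed mult_add_right add1 ER.T.add_minus_add\<close>)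
  have ract_scale: "ract forms t (c \<odot>\<^bsub>R\<^esub> a) = c \<odot>\<^bsub>?T\<^esub> ract forms t a"
    if "c \<in> carrier V" "a \<in> carrier R" "t \<in> carrier ?T" for c a t
    by (rule eqI[OF _ _ _ that(3)])
      (use that in \<open>auto intro!: linear simp: pure closed mult_smult_right smult1 ER.T.smult_minus\<close>)
  \<comment> \<open>Acting twice on \<open>\<omega> dy\<close> produces
    \<open>(\<omega> y a) db\<close> with both signs; what remains is
    \<open>\<omega> d(yab) - (\<omega> y) d(ab)\<close>.\<close>
  have ract_mult: "ract forms t (a \<otimes>\<^bsub>R\<^esub> b) = ract forms (ract forms t a) b"
    if "a \<in> carrier R" "b \<in> carrier R" "t \<in> carrier ?T" for a b t
    by (rule eqI[OF _ _ _ that(3)])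
      (use that in \<open>auto intro!: linear simp: pure closed mult_assoc ract_assoc
          TT.linear_maps_minus[OF forms_ract_linear] ER.T.minus_minus_minus\<close>)
  have middle: "ract forms (lact forms a t) b = lact forms a (ract forms t b)"
    if "a \<in> carrier R" "b \<in> carrier R" "t \<in> carrier ?T" for a b t
    by (rule eqI[OF _ _ _ that(3)])
      (use that in \<open>auto intro!: linear simp: pure closed lact_ract
          TT.linear_maps_minus[OF forms_lact_linear]\<close>)
  interpret F: module V forms by (rule forms_module)
  show ?thesis
    by unfold_locales
      (simp_all add: linear_maps_closed[OF forms_lact_linear] linear_maps_closed[OF forms_ract_linear]
        linear_maps_add[OF forms_lact_linear] linear_maps_add[OF forms_ract_linear]
        linear_maps_smult[OF forms_lact_linear] linear_maps_smult[OF forms_ract_linear]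
        lact_plus lact_scale lact_mult ract_plus ract_scale ract_mult middle)
qed

end

context nonunital_algebra
begin

lemma bimodule_unital: "bimodule V R (unital_bimodule V R)"
proof -
  let ?U = "unital_bimodule V R"
  note defs = unital_bimodule_def unitalisation_def Let_def bimodule.defs module.defs
  have "module V ?U"
  proof (rule moduleI)
    show "abelian_group ?U"
    proof (rule abelian_groupI)
      show "\<exists>y\<in>carrier ?U. y \<oplus>\<^bsub>?U\<^esub> x = \<zero>\<^bsub>?U\<^esub>" if "x \<in> carrier ?U" for x
        using that
        by (intro bexI[of _ "(\<ominus>\<^bsub>R\<^esub> fst x, \<ominus>\<^bsub>V\<^esub> snd x)"]) (auto simp: defs M.l_neg R.l_neg)
    qed (auto simp: defs M.a_ac R.a_ac)
  qed (auto simp: defs smult_l_distr smult_r_distr smult_assoc1 R.l_distr R.r_distr R.m_assoc R.is_cring)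
  then interpret U: module V ?U .
  \<comment> \<open>A product in the unitalisation scales each factor by the
    \<open>V\<close>-coordinate of the other, so nested scalars turn up in both orders.\<close>
  have smult_comm: "c \<odot>\<^bsub>R\<^esub> (d \<odot>\<^bsub>R\<^esub> x) = d \<odot>\<^bsub>R\<^esub> (c \<odot>\<^bsub>R\<^esub> x)"
    if "c \<in> carrier V" "d \<in> carrier V" "x \<in> carrier R" for c d x
    using that by (simp add: smult_assoc1[symmetric] R.m_comm)
  show ?thesis
    by unfold_locales
      (auto simp: defs mult_closed mult_assoc mult_add_left mult_add_right mult_smult_left
        mult_smult_right smult_l_distr smult_r_distr smult_assoc1 smult_comm M.a_ac)
qed

end

section \<open>Existence of a connection\<close>

lemma bimodule_image:
  assumes M: "bimodule V R M" and surj: "p ` carrier M = carrier Q"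
    and add: "\<And>x y. x \<in> carrier M \<Longrightarrow> y \<in> carrier M \<Longrightarrow> p (x \<oplus>\<^bsub>M\<^esub> y) = p x \<oplus>\<^bsub>Q\<^esub> p y"
    and smult: "\<And>c x. c \<in> carrier V \<Longrightarrow> x \<in> carrier M \<Longrightarrow> p (c \<odot>\<^bsub>M\<^esub> x) = c \<odot>\<^bsub>Q\<^esub> p x"
    and zero: "p \<zero>\<^bsub>M\<^esub> = \<zero>\<^bsub>Q\<^esub>"
    and lact: "\<And>a x. a \<in> carrier R \<Longrightarrow> x \<in> carrier M \<Longrightarrow> p (lact M a x) = lact Q a (p x)"
    and ract: "\<And>a x. a \<in> carrier R \<Longrightarrow> x \<in> carrier M \<Longrightarrow> p (ract M x a) = ract Q (p x) a"
  shows "bimodule V R Q"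
proof -
  interpret M: bimodule V R M by fact
  interpret Q: module V Q
    by (rule module_image[OF M.E.module_axioms surj add smult zero])
  note ops = add[symmetric] smult[symmetric] lact[symmetric] ract[symmetric]
  note laws = M.lact_closed M.lact_add_left M.lact_add_right M.lact_smult_left M.lact_smult_right
    M.lact_assoc M.ract_closed M.ract_add_left M.ract_add_right M.ract_smult_left
    M.ract_smult_right M.ract_assoc M.lact_ract
  show ?thesis
    by unfold_locales (auto simp flip: surj simp: ops laws M.mult_closed)
qed

text \<open>The structure on the image of \<open>j\<close> that makes \<open>j\<close> an
  isomorphism when \<open>j\<close> is injective on \<open>carrier Q\<close>. All operations go back
  through \<open>i\<close>, since \<open>j\<close> has no inverse on the whole type.\<close>

definition transport_bimodule ::
    "('m \<Rightarrow> 'n) \<Rightarrow> ('v, 'r, 'm, 'x) bimodule_scheme \<Rightarrow> ('v, 'r, 'n) bimodule" where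
  "transport_bimodule j Q =
     (let i = inv_into (carrier Q) j in
      \<lparr>carrier = j ` carrier Q, monoid.mult = undefined, one = undefined,
       ring.zero = j \<zero>\<^bsub>Q\<^esub>, add = (\<lambda>x y. j (i x \<oplus>\<^bsub>Q\<^esub> i y)),
       smult = (\<lambda>c x. j (c \<odot>\<^bsub>Q\<^esub> i x)),
       lact = (\<lambda>a x. j (lact Q a (i x))), ract = (\<lambda>x a. j (ract Q (i x) a))\<rparr>)"

lemma
  assumes Q: "bimodule V R Q" and inj: "inj_on j (carrier Q)"
  shows bimodule_transport: "bimodule V R (transport_bimodule j Q)"
    and transport_inverse_hom:
      "inv_into (carrier Q) j \<in> bimodule_homs V R (transport_bimodule j Q) Q"
proof -
  interpret Q: bimodule V R Q by fact
  note defs = transport_bimodule_def Let_def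
  note inv = inv_into_f_f[OF inj]
  note closed = Q.lact_closed Q.ract_closed
  show "bimodule V R (transport_bimodule j Q)"
    by (rule bimodule_image[OF Q, of j]) (simp_all add: defs inv)
  show "inv_into (carrier Q) j \<in> bimodule_homs V R (transport_bimodule j Q) Q"
    by (auto simp: bimodule_homs_def linear_maps_def defs inv closed)
qed

lemma bimodule_homs_comp:
  assumes f: "f \<in> bimodule_homs V R E Y" and g: "g \<in> bimodule_homs V R Y Z"
  shows "(\<lambda>x. g (f x)) \<in> bimodule_homs V R E Z"
proof -
  have "f \<in> linear_maps V E Y" using f by (simp add: bimodule_homs_def)
  then show ?thesis
    using f g linear_maps_comp[of f V E Y g Z] linear_maps_closed[of f V E Y]
    by (auto simp: bimodule_homs_def)
qed

text \<open>
  The lifting property only tests bimodules of one type, so a bimodule of another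
  type is first moved into it along the injection \<open>j\<close>.
\<close>

lemma projective_section:
  fixes P :: "('v, 'r, 'p) bimodule" and V :: "('v, 'z) ring_scheme"
    and j :: "'q \<Rightarrow> 'p \<Rightarrow> (('r \<times> 'v) \<times> ('r \<times> 'v) \<Rightarrow> 'v) set"
  assumes P: "projective_bimodule V R P" and Q: "bimodule V R Q"
    and inj: "inj_on j (carrier Q)"
    and f: "f \<in> bimodule_homs V R Q P" and surj: "f ` carrier Q = carrier P"
  shows "\<exists>h\<in>bimodule_homs V R P Q. \<forall>p\<in>carrier P. f (h p) = p"
proof -
  let ?E = "transport_bimodule j Q" and ?i = "inv_into (carrier Q) j"
  have E: "bimodule V R ?E" and i: "?i \<in> bimodule_homs V R ?E Q"
    by (rule bimodule_transport[OF Q inj] transport_inverse_hom[OF Q inj])+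
  have fi: "(\<lambda>x. f (?i x)) \<in> bimodule_homs V R ?E P"
    by (rule bimodule_homs_comp[OF i f])
  have "carrier ?E = j ` carrier Q" by (simp add: transport_bimodule_def Let_def)
  then have onto: "(\<lambda>x. f (?i x)) ` carrier ?E = carrier P"
    using surj inv_into_f_f[OF inj] by (force simp: image_image)
  \<comment> \<open>With \<open>Y = P\<close> and the identity as the map to be lifted, the lifting
    property yields a section.\<close>
  have "(\<lambda>p. p) \<in> bimodule_homs V R P P"
    by (auto simp: bimodule_homs_def linear_maps_def)
  then obtain h where h: "h \<in> bimodule_homs V R P ?E" "\<forall>p\<in>carrier P. f (?i (h p)) = p"
    using P E fi onto unfolding projective_bimodule_def by blast
  show ?thesis
    using bimodule_homs_comp[OF h(1) i] h(2) by (intro bexI[of _ "\<lambda>x. ?i (h x)"]) auto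
qed

section \<open>The twisted extension and its splitting\<close>

definition twisted_forms ::
    "('v, 'z) ring_scheme \<Rightarrow> ('v, 'r, 'y) module_scheme \<Rightarrow> ('v, 'r, 'm, 'x) bimodule_scheme
      \<Rightarrow> ('v, 'r, ('m \<times> 'r \<Rightarrow> 'v) set \<times> 'm) bimodule" where
  "twisted_forms V R E =
     (let W = forms_step V R E in
      \<lparr>carrier = carrier W \<times> carrier E, monoid.mult = undefined, one = undefined,
       ring.zero = (\<zero>\<^bsub>W\<^esub>, \<zero>\<^bsub>E\<^esub>),
       add = (\<lambda>(\<eta>, \<omega>) (\<eta>', \<omega>'). (\<eta> \<oplus>\<^bsub>W\<^esub> \<eta>', \<omega> \<oplus>\<^bsub>E\<^esub> \<omega>')),
       smult = (\<lambda>c (\<eta>, \<omega>). (c \<odot>\<^bsub>W\<^esub> \<eta>, c \<odot>\<^bsub>E\<^esub> \<omega>)),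
       lact = (\<lambda>a (\<eta>, \<omega>). (lact W a \<eta>, lact E a \<omega>)),
       ract = (\<lambda>(\<eta>, \<omega>) a. (ract W \<eta> a \<oplus>\<^bsub>W\<^esub> pure_tensor V E R \<omega> a, ract E \<omega> a))\<rparr>)"

text \<open>The delicate axiom is associativity of the right action. Acting by \<open>a\<close> and
  then \<open>b\<close> adds \<open>(\<omega> da) b + (\<omega> a) db\<close> to
  \<open>\<eta> a b\<close>. Since \<open>(\<omega> da) b\<close> is
  \<open>\<omega> d(ab) - (\<omega> a) db\<close>, this is \<open>\<omega> d(ab)\<close>, as
  required for acting by \<open>ab\<close>; \<open>cancel\<close> is this computation.\<close>

lemma (in bimodule) bimodule_twisted_forms: "bimodule V R (twisted_forms V R E)"
proof -
  let ?T = "tensor V E R" and ?W = "twisted_forms V R E"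
  interpret Om: bimodule V R forms by (rule bimodule_forms_step)
  note defs = twisted_forms_def Let_def
  have "module V ?W"
  proof (rule moduleI)
    show "abelian_group ?W"
    proof (rule abelian_groupI)
      show "\<exists>y\<in>carrier ?W. y \<oplus>\<^bsub>?W\<^esub> x = \<zero>\<^bsub>?W\<^esub>" if "x \<in> carrier ?W" for x
        using that
        by (intro bexI[of _ "(\<ominus>\<^bsub>?T\<^esub> fst x, \<ominus>\<^bsub>E\<^esub> snd x)"]) (auto simp: defs ER.T.l_neg E.M.l_neg)
    next
      fix x y z assume "x \<in> carrier ?W" "y \<in> carrier ?W" "z \<in> carrier ?W"
      then show "x \<oplus>\<^bsub>?W\<^esub> y \<oplus>\<^bsub>?W\<^esub> z = x \<oplus>\<^bsub>?W\<^esub> (y \<oplus>\<^bsub>?W\<^esub> z)"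
        by (auto simp: defs ER.T.a_assoc E.M.a_assoc)
    next
      fix x y assume "x \<in> carrier ?W" "y \<in> carrier ?W"
      then show "x \<oplus>\<^bsub>?W\<^esub> y = y \<oplus>\<^bsub>?W\<^esub> x" by (auto simp: defs ER.T.a_comm E.M.a_comm)
    qed (auto simp: defs)
  qed (auto simp: defs ER.T.smult_l_distr ER.T.smult_r_distr ER.T.smult_assoc1
      E.smult_l_distr E.smult_r_distr E.smult_assoc1 R.is_cring)
  then interpret W: module V ?W .
  note closed = lact_closed ract_closed mult_closed ER.pure_tensor_closed
    Om.lact_closed[simplified] Om.ract_closed[simplified]
  note laws = lact_add_left lact_add_right lact_smult_left lact_smult_right
    lact_assoc ract_add_left ract_add_right ract_smult_left
    ract_smult_right ract_assoc lact_ract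
  note Olaws = Om.lact_add_left[simplified] Om.lact_add_right[simplified]
    Om.lact_smult_left[simplified] Om.lact_smult_right[simplified]
    Om.lact_assoc[simplified] Om.ract_add_left[simplified] Om.ract_add_right[simplified]
    Om.ract_smult_left[simplified] Om.ract_smult_right[simplified] Om.ract_assoc[simplified]
    Om.lact_ract[simplified]
  note dlaws = linear_maps_add[OF ER.pure_tensor_linear(1)] linear_maps_add[OF ER.pure_tensor_linear(2)]
    linear_maps_smult[OF ER.pure_tensor_linear(1)] linear_maps_smult[OF ER.pure_tensor_linear(2)]
    forms_lact_pure forms_ract_pure
  have cancel: "(p \<oplus>\<^bsub>?T\<^esub> (q \<ominus>\<^bsub>?T\<^esub> r)) \<oplus>\<^bsub>?T\<^esub> r = p \<oplus>\<^bsub>?T\<^esub> q"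
    if "p \<in> carrier ?T" "q \<in> carrier ?T" "r \<in> carrier ?T" for p q r
    using that by (simp add: a_minus_def ER.T.a_assoc ER.T.l_neg)
  \<comment> \<open>For additivity of the right action: the terms \<open>\<eta> a\<close> and
    \<open>\<omega> da\<close> of two summands have to be regrouped.\<close>
  have swap: "(p \<oplus>\<^bsub>?T\<^esub> q) \<oplus>\<^bsub>?T\<^esub> (r \<oplus>\<^bsub>?T\<^esub> s) = (p \<oplus>\<^bsub>?T\<^esub> r) \<oplus>\<^bsub>?T\<^esub> (q \<oplus>\<^bsub>?T\<^esub> s)"
    if "p \<in> carrier ?T" "q \<in> carrier ?T" "r \<in> carrier ?T" "s \<in> carrier ?T" for p q r s
    using that by (simp add: ER.T.a_ac)
  show ?thesis
    by unfold_locales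
      (auto simp: defs closed laws Olaws dlaws ER.T.smult_r_distr swap cancel)
qed

text \<open>Distinct cosets are disjoint, so any one representative determines its tensor. With the
  next lemma, choosing a representative is an injective encoding of tensors.\<close>

lemma (in bimodule) tensor_coset_eqI:
  assumes "s \<in> carrier (tensor V E R)" "t \<in> carrier (tensor V E R)" "f \<in> s" "f \<in> t"
  shows "s = t"
proof -
  have "u = ER.proj f" if u: "u \<in> carrier (tensor V E R)" "f \<in> u" for u
  proof -
    obtain g where g: "g \<in> carrier ER.pairs" "u = ER.proj g"
      using ER.proj_surj[OF u(1)] by (elim bexE)
    have "ER.proj g = ER.proj f"
      by (rule ER.F.a_repr_independence[OF _ g(1) submodule.axioms(1)[OF ER.tensor_kernel_submodule]])
        (use u(2) g(2) in simp)
    then show ?thesis by (simp add: g(2))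
  qed
  from this[OF assms(1,3)] this[OF assms(2,4)] show ?thesis by simp
qed

lemma (in bimodule) tensor_coset_some:
  assumes "t \<in> carrier (tensor V E R)"
  shows "(SOME f. f \<in> t) \<in> t"
proof -
  obtain g where "t = ER.proj g" using ER.proj_surj[OF assms] by (elim bexE)
  then have "\<zero>\<^bsub>ER.pairs\<^esub> \<oplus>\<^bsub>ER.pairs\<^esub> g \<in> t"
    using ER.F.zero_in_submodule[OF ER.tensor_kernel_submodule] by (auto simp: a_r_coset_def')
  then show ?thesis by (rule someI[of "\<lambda>f. f \<in> t"])
qed

text \<open>
  The injection encodes a form by a representing function, in the \<open>V\<close>-coordinate \<open>\<zero>\<close>, and
  the second component by its indicator function, in the other \<open>V\<close>-coordinates.
\<close>

lemma (in bimodule) twisted_forms_injection: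
  assumes "\<one>\<^bsub>V\<^esub> \<noteq> \<zero>\<^bsub>V\<^esub>"
  shows "\<exists>j :: _ \<Rightarrow> 'm \<Rightarrow> (('r \<times> 'v) \<times> ('r \<times> 'v) \<Rightarrow> 'v) set.
    inj_on j (carrier (twisted_forms V R E))"
proof -
  \<comment> \<open>The argument \<open>p\<close> and the coordinate \<open>x\<close> together form
    the index \<open>(p, x)\<close> of a representing function; the second factor of type
    \<open>'r \<times> 'v\<close> is ignored. The target type asks for a set of functions, hence the
    singleton.\<close>
  define j :: "_ \<Rightarrow> 'm \<Rightarrow> (('r \<times> 'v) \<times> ('r \<times> 'v) \<Rightarrow> 'v) set" where
    "j = (\<lambda>(t, \<omega>) p. {\<lambda>((x, c), _). if c = \<zero>\<^bsub>V\<^esub> then (SOME f. f \<in> t) (p, x)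
       else if p = \<omega> then \<one>\<^bsub>V\<^esub> else \<zero>\<^bsub>V\<^esub>})"
  have "inj_on j (carrier (twisted_forms V R E))"
  proof (rule inj_onI, clarify)
    fix t \<omega> t' \<omega>'
    assume mem: "(t, \<omega>) \<in> carrier (twisted_forms V R E)" "(t', \<omega>') \<in> carrier (twisted_forms V R E)"
      and eq: "j (t, \<omega>) = j (t', \<omega>')"
    have enc: "(\<lambda>((x, c), _). if c = \<zero>\<^bsub>V\<^esub> then (SOME f. f \<in> t) (p, x)
         else if p = \<omega> then \<one>\<^bsub>V\<^esub> else \<zero>\<^bsub>V\<^esub>)
       = (\<lambda>((x, c), _ :: 'r \<times> 'v). if c = \<zero>\<^bsub>V\<^esub> then (SOME f. f \<in> t') (p, x)
         else if p = \<omega>' then \<one>\<^bsub>V\<^esub> else \<zero>\<^bsub>V\<^esub>)" for p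
      using fun_cong[OF eq, of p] by (simp add: j_def)
    have "(SOME f. f \<in> t) (p, x) = (SOME f. f \<in> t') (p, x)" for p x
      using fun_cong[OF enc, of p "((x, \<zero>\<^bsub>V\<^esub>), undefined)"] by simp
    then have "(SOME f. f \<in> t) = (SOME f. f \<in> t')" by (auto simp: fun_eq_iff)
    then have "t = t'"
      using mem tensor_coset_some tensor_coset_eqI
      by (simp add: twisted_forms_def Let_def) metis
    \<comment> \<open>The indicator functions are compared at \<open>p = \<omega>\<close> and in the
      coordinate \<open>\<one>\<close>. That \<open>\<one>\<close> and \<open>\<zero>\<close> differ
      is used twice: to reach the second branch and to tell the values of the indicator
      apart.\<close>
    moreover have "\<omega> = \<omega>'"
      using fun_cong[OF enc, of \<omega> "((undefined, \<one>\<^bsub>V\<^esub>), undefined)"] assms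
      by (simp split: if_splits)
    ultimately show "t = t' \<and> \<omega> = \<omega>'" by blast
  qed
  then show ?thesis by blast
qed

lemma (in nonunital_algebra) connection_exists:
  assumes qf: "quasi_free V R" and nontriv: "\<one>\<^bsub>V\<^esub> \<noteq> \<zero>\<^bsub>V\<^esub>"
  shows "\<exists>nabla. forms_connection V R nabla"
proof -
  let ?O1 = "Omega1 V R" and ?W = "twisted_forms V R (Omega1 V R)"
  have proj: "projective_bimodule V R ?O1" using qf by (simp add: quasi_free_def)
  then interpret O1: bimodule V R ?O1 by (simp add: projective_bimodule_def)
  note defs = twisted_forms_def Let_def
  obtain j :: "_ \<Rightarrow> (('r \<times> 'v) \<times> 'r \<Rightarrow> 'v) set \<Rightarrow> (('r \<times> 'v) \<times> ('r \<times> 'v) \<Rightarrow> 'v) set"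
    where j: "inj_on j (carrier ?W)"
    using O1.twisted_forms_injection[OF nontriv] by (elim exE)
  have f: "snd \<in> bimodule_homs V R ?W ?O1"
    by (auto simp: bimodule_homs_def linear_maps_def defs)
  have surj: "snd ` carrier ?W = carrier ?O1"
    using O1.ER.T.zero_closed by (force simp: defs)
  obtain h where h: "h \<in> bimodule_homs V R ?O1 ?W" "\<And>\<omega>. \<omega> \<in> carrier ?O1 \<Longrightarrow> snd (h \<omega>) = \<omega>"
    using projective_section[OF proj O1.bimodule_twisted_forms j f surj] by (elim bexE) simp
  have lin: "h \<in> linear_maps V ?O1 ?W" using h(1) by (simp add: bimodule_homs_def)
  have act: "h (lact ?O1 a \<omega>) = lact ?W a (h \<omega>)" "h (ract ?O1 \<omega> a) = ract ?W (h \<omega>) a"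
    if "a \<in> carrier R" "\<omega> \<in> carrier ?O1" for a \<omega>
    using h(1) that by (simp_all add: bimodule_homs_def)
  \<comment> \<open>As \<open>snd (h \<omega>) = \<omega>\<close>, the extra term of the twisted
    action on \<open>h \<omega>\<close> is exactly \<open>\<omega> da\<close>, so right linearity of
    \<open>h\<close> becomes the Leibniz rule in the first component.\<close>
  have "forms_connection V R (\<lambda>\<omega>. fst (h \<omega>))"
    unfolding forms_connection_def Omega2_def form2_def
  proof (intro conjI ballI)
    show "(\<lambda>\<omega>. fst (h \<omega>)) \<in> linear_maps V ?O1 (forms_step V R ?O1)"
      using linear_maps_closed[OF lin] linear_maps_add[OF lin] linear_maps_smult[OF lin]
      by (intro linear_mapsI) (simp_all add: defs split_beta mem_Times_iff)
  next
    fix a \<omega> assume "a \<in> carrier R" "\<omega> \<in> carrier ?O1"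
    then show "fst (h (lact ?O1 a \<omega>)) = lact (forms_step V R ?O1) a (fst (h \<omega>))"
      and "fst (h (ract ?O1 \<omega> a)) = ract (forms_step V R ?O1) (fst (h \<omega>)) a
        \<oplus>\<^bsub>forms_step V R ?O1\<^esub> pure_tensor V ?O1 R \<omega> a"
      by (simp_all add: act h(2) defs split_beta)
  qed
  then show ?thesis by blast
qed

section \<open>Finite degree\<close>

lemma (in module) submodule_Union_chain:
  assumes N: "\<And>n. submodule (N n) R M" and mono: "\<And>m n. m \<le> n \<Longrightarrow> N m \<subseteq> N n"
  shows "submodule (\<Union>n::nat. N n) R M"
proof (rule submoduleI)
  fix a b assume "a \<in> (\<Union>n. N n)" "b \<in> (\<Union>n. N n)"
  then obtain m n where "a \<in> N m" "b \<in> N n" by blast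
  then have "a \<in> N (max m n)" "b \<in> N (max m n)"
    using mono[of m "max m n"] mono[of n "max m n"] by auto
  then show "a \<oplus>\<^bsub>M\<^esub> b \<in> (\<Union>n. N n)" using submoduleE(5)[OF N] by blast
next
  show "(\<Union>n. N n) \<subseteq> carrier M" using submoduleE(1)[OF N] by blast
  show "\<zero>\<^bsub>M\<^esub> \<in> (\<Union>n. N n)" using zero_in_submodule[OF N] by blast
  show "\<ominus>\<^bsub>M\<^esub> a \<in> (\<Union>n. N n)" if "a \<in> (\<Union>n. N n)" for a
    using submoduleE(3)[OF N] that by blast
  show "c \<odot>\<^bsub>M\<^esub> a \<in> (\<Union>n. N n)" if "c \<in> carrier R" "a \<in> (\<Union>n. N n)" for c a
    using submoduleE(4)[OF N] that by blast
qed

lemma products_mono: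
  assumes "A \<subseteq> B" "i \<ge> 1"
  shows "products R A i \<subseteq> products R B i"
  using assms(2)
proof (induction i rule: dec_induct)
  case base
  then show ?case using assms(1) by simp
next
  case (step n)
  then obtain n' where "n = Suc n'" using not0_implies_Suc by fastforce
  then show ?case using step.IH assms(1) by fastforce
qed

context nonunital_algebra
begin

lemma products_closed:
  assumes "A \<subseteq> carrier R"
  shows "products R A i \<subseteq> carrier R"
proof (induction i)
  case (Suc i)
  then show ?case using assms by (cases i) (auto intro!: mult_closed)
qed (auto simp: identities_def)

end

section \<open>Degrees with respect to a fixed submodule\<close>

locale degree_filtration = nonunital_algebra V R
  for V :: "('v, 'z) ring_scheme" (structure) and R :: "('v, 'r, 'y) module_scheme" (structure) +
  fixes M :: "'r set"
  assumes M: "submodule M V R"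
begin

abbreviation "O1 \<equiv> Omega1 V R"
abbreviation "O2 \<equiv> Omega2 V R"
abbreviation "P \<equiv> power_sum V R M"
abbreviation "F1 \<equiv> forms_filtration1 V R M"
abbreviation "F2 \<equiv> forms_filtration2 V R M"
abbreviation "U \<equiv> unital_bimodule V R"
abbreviation "d y \<equiv> form1 V R (\<zero>\<^bsub>R\<^esub>, \<one>\<^bsub>V\<^esub>) y"

sublocale U: bimodule V R U
  by (rule bimodule_unital)

sublocale O1: bimodule V R O1
  unfolding Omega1_def by (rule U.bimodule_forms_step)

sublocale O2: bimodule V R O2
  unfolding Omega2_def by (rule O1.bimodule_forms_step)

lemma M_subset: "M \<subseteq> carrier R"
  by (rule submoduleE(1)[OF M])

lemma power_sum_gens: "(\<Union>i\<in>{1..n}. products R M i) \<subseteq> carrier R"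
  using products_closed[OF M_subset] by blast

lemma power_sum_submodule: "submodule (P n) V R"
  unfolding power_sum_def by (rule submodule_span_is_submodule[OF power_sum_gens])

lemma power_sum_closed: "x \<in> P n \<Longrightarrow> x \<in> carrier R"
  using submoduleE(1)[OF power_sum_submodule] by blast

lemma power_sum_mono: "m \<le> n \<Longrightarrow> P m \<subseteq> P n"
  unfolding power_sum_def by (rule submodule_span_mono) force

lemma products_subset_power_sum: "1 \<le> i \<Longrightarrow> i \<le> n \<Longrightarrow> products R M i \<subseteq> P n"
  unfolding power_sum_def
  by (rule subset_trans[OF UN_upper submodule_span_superset]) simp

lemma power_sum_least:
  assumes "submodule N V R" "\<And>i. 1 \<le> i \<Longrightarrow> i \<le> n \<Longrightarrow> products R M i \<subseteq> N"
  shows "P n \<subseteq> N"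
  unfolding power_sum_def by (rule submodule_span_least[OF assms(1)]) (use assms(2) in \<open>simp add: UN_subset_iff\<close>)

text \<open>The preimage of \<open>N\<close> is a submodule, so a claim that is linear in
  \<open>x\<close> is tested on words of length 1 to \<open>n\<close>.\<close>

lemma linear_map_power_sum:
  assumes "module V Q" and f: "f \<in> linear_maps V R Q" and N: "submodule N V Q"
    and gens: "\<And>i x. 1 \<le> i \<Longrightarrow> i \<le> n \<Longrightarrow> x \<in> products R M i \<Longrightarrow> f x \<in> N"
    and x: "x \<in> P n"
  shows "f x \<in> N"
proof -
  interpret Q: module V Q by fact
  interpret RQ: two_modules V R Q ..
  have "P n \<subseteq> {x \<in> carrier R. f x \<in> N}"
    by (rule power_sum_least[OF RQ.submodule_vimage[OF f N]])
      (use gens products_closed[OF M_subset] in blast)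
  then show ?thesis using x by blast
qed

lemma products_mult:
  assumes "1 \<le> i" "1 \<le> j" "x \<in> products R M i" "y \<in> products R M j"
  shows "x \<otimes>\<^bsub>R\<^esub> y \<in> products R M (i + j)"
  using assms(1,3)
proof (induction i arbitrary: x rule: dec_induct)
  case base
  then show ?case using assms(2,4) by (cases j) auto
next
  case (step n)
  then obtain n' where n: "n = Suc n'" using not0_implies_Suc by fastforce
  then obtain a b where ab: "x = a \<otimes>\<^bsub>R\<^esub> b" "a \<in> M" "b \<in> products R M n"
    using step.prems by auto
  then have "x \<otimes>\<^bsub>R\<^esub> y = a \<otimes>\<^bsub>R\<^esub> (b \<otimes>\<^bsub>R\<^esub> y)"
    using assms(4) M_subset products_closed[OF M_subset] by (auto intro!: mult_assoc)
  moreover have "b \<otimes>\<^bsub>R\<^esub> y \<in> products R M (n + j)" using step.IH ab(3) by blast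
  ultimately show ?case using ab(2) n by auto
qed

text \<open>The product is linear in each factor separately. Reducing one factor at a time to words
  leaves the concatenation of two words.\<close>

lemma power_sum_mult:
  assumes x: "x \<in> P i" and y: "y \<in> P j"
  shows "x \<otimes>\<^bsub>R\<^esub> y \<in> P (i + j)"
proof (rule linear_map_power_sum[OF module_axioms mult_right_linear power_sum_submodule _ x])
  show "y \<in> carrier R" by (rule power_sum_closed[OF y])
  fix k a assume k: "1 \<le> k" "k \<le> i" "a \<in> products R M k"
  then have a: "a \<in> carrier R" using products_closed[OF M_subset] by blast
  show "a \<otimes>\<^bsub>R\<^esub> y \<in> P (i + j)"
  proof (rule linear_map_power_sum[OF module_axioms mult_left_linear[OF a] power_sum_submodule _ y])
    fix l b assume l: "1 \<le> l" "l \<le> j" "b \<in> products R M l"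
    then have "a \<otimes>\<^bsub>R\<^esub> b \<in> products R M (k + l)" using products_mult k by blast
    then show "a \<otimes>\<^bsub>R\<^esub> b \<in> P (i + j)"
      using products_subset_power_sum[of "k + l" "i + j"] k l by auto
  qed
qed

text \<open>The possible coefficients of a generating form of degree \<open>i\<close>: elements of
  \<open>P i\<close>, or the adjoined unit, which counts as degree 0 and so is allowed for every
  \<open>i\<close>. It is a set of generators and not a submodule; it lets both families in
  \<open>forms_filtration2\<close> be treated at once.\<close>

definition unital_part :: "nat \<Rightarrow> ('r \<times> 'v) set" where
  "unital_part i = insert (\<zero>\<^bsub>R\<^esub>, \<one>\<^bsub>V\<^esub>) (P i \<times> {\<zero>\<^bsub>V\<^esub>})"

lemma unital_simps:
  "carrier U = carrier R \<times> carrier V"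
  "lact U a (x, c) = (a \<otimes>\<^bsub>R\<^esub> x \<oplus>\<^bsub>R\<^esub> (c \<odot>\<^bsub>R\<^esub> a \<oplus>\<^bsub>R\<^esub> \<zero>\<^bsub>V\<^esub> \<odot>\<^bsub>R\<^esub> x), \<zero>\<^bsub>V\<^esub> \<otimes>\<^bsub>V\<^esub> c)"
  "ract U (x, c) a = (x \<otimes>\<^bsub>R\<^esub> a \<oplus>\<^bsub>R\<^esub> (\<zero>\<^bsub>V\<^esub> \<odot>\<^bsub>R\<^esub> x \<oplus>\<^bsub>R\<^esub> c \<odot>\<^bsub>R\<^esub> a), c \<otimes>\<^bsub>V\<^esub> \<zero>\<^bsub>V\<^esub>)"
  "(x, c) \<oplus>\<^bsub>U\<^esub> (y, e) = (x \<oplus>\<^bsub>R\<^esub> y, c \<oplus>\<^bsub>V\<^esub> e)"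
  "s \<odot>\<^bsub>U\<^esub> (x, c) = (s \<odot>\<^bsub>R\<^esub> x, s \<otimes>\<^bsub>V\<^esub> c)"
  by (simp_all add: unital_bimodule_def unitalisation_def Let_def bimodule.defs module.defs)

lemma mult_zero: "x \<in> carrier R \<Longrightarrow> x \<otimes>\<^bsub>R\<^esub> \<zero>\<^bsub>R\<^esub> = \<zero>\<^bsub>R\<^esub>" "x \<in> carrier R \<Longrightarrow> \<zero>\<^bsub>R\<^esub> \<otimes>\<^bsub>R\<^esub> x = \<zero>\<^bsub>R\<^esub>"
  using mult_smult_right[of "\<zero>\<^bsub>V\<^esub>" x "\<zero>\<^bsub>R\<^esub>"] mult_smult_left[of "\<zero>\<^bsub>V\<^esub>" "\<zero>\<^bsub>R\<^esub>" x]
  by (simp_all add: mult_closed)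

lemma unital_part_closed: "unital_part i \<subseteq> carrier U"
  by (auto simp: unital_part_def unital_simps power_sum_closed)

text \<open>If \<open>u\<close> is the adjoined unit, the product is \<open>(a, \<zero>)\<close> of
  degree \<open>i\<close>, and monotonicity raises this to \<open>i + j\<close>.\<close>

lemma unital_part_lact: "a \<in> P i \<Longrightarrow> u \<in> unital_part j \<Longrightarrow> lact U a u \<in> unital_part (i + j)"
  using power_sum_mult[of a i _ j] power_sum_mono[of i "i + j"]
  by (auto simp: unital_part_def unital_simps power_sum_closed mult_closed mult_zero)

lemma unital_part_ract: "a \<in> P i \<Longrightarrow> u \<in> unital_part j \<Longrightarrow> ract U u a \<in> unital_part (j + i)"
  using power_sum_mult[of _ j a i] power_sum_mono[of i "j + i"]
  by (auto simp: unital_part_def unital_simps power_sum_closed mult_closed mult_zero)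

lemma form1_closed: "u \<in> carrier U \<Longrightarrow> y \<in> carrier R \<Longrightarrow> form1 V R u y \<in> carrier O1"
  unfolding form1_def Omega1_def by (simp add: U.ER.pure_tensor_closed)

lemma form2_closed: "\<omega> \<in> carrier O1 \<Longrightarrow> z \<in> carrier R \<Longrightarrow> form2 V R \<omega> z \<in> carrier O2"
  unfolding form2_def Omega2_def by (simp add: O1.ER.pure_tensor_closed)

lemma form1_linear:
  shows "u \<in> carrier U \<Longrightarrow> form1 V R u \<in> linear_maps V R O1"
    and "y \<in> carrier R \<Longrightarrow> (\<lambda>u. form1 V R u y) \<in> linear_maps V U O1"
  unfolding form1_def Omega1_def linear_maps_forms_step by (rule U.ER.pure_tensor_linear; assumption)+

lemma form2_linear:
  shows "\<omega> \<in> carrier O1 \<Longrightarrow> form2 V R \<omega> \<in> linear_maps V R O2"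
    and "z \<in> carrier R \<Longrightarrow> (\<lambda>\<omega>. form2 V R \<omega> z) \<in> linear_maps V O1 O2"
  unfolding form2_def Omega2_def linear_maps_forms_step by (rule O1.ER.pure_tensor_linear; assumption)+

lemma lact_form1:
  "a \<in> carrier R \<Longrightarrow> u \<in> carrier U \<Longrightarrow> y \<in> carrier R
    \<Longrightarrow> lact O1 a (form1 V R u y) = form1 V R (lact U a u) y"
  unfolding form1_def Omega1_def by (rule U.forms_lact_pure)

lemma ract_form1:
  "a \<in> carrier R \<Longrightarrow> u \<in> carrier U \<Longrightarrow> y \<in> carrier R
    \<Longrightarrow> ract O1 (form1 V R u y) a = form1 V R u (y \<otimes>\<^bsub>R\<^esub> a) \<ominus>\<^bsub>O1\<^esub> form1 V R (ract U u y) a"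
  unfolding form1_def Omega1_def using U.forms_ract_pure by simp

lemma lact_form2:
  "a \<in> carrier R \<Longrightarrow> \<omega> \<in> carrier O1 \<Longrightarrow> z \<in> carrier R
    \<Longrightarrow> lact O2 a (form2 V R \<omega> z) = form2 V R (lact O1 a \<omega>) z"
  unfolding form2_def Omega2_def by (rule O1.forms_lact_pure)

lemma ract_form2:
  "a \<in> carrier R \<Longrightarrow> \<omega> \<in> carrier O1 \<Longrightarrow> z \<in> carrier R
    \<Longrightarrow> ract O2 (form2 V R \<omega> z) a = form2 V R \<omega> (z \<otimes>\<^bsub>R\<^esub> a) \<ominus>\<^bsub>O2\<^esub> form2 V R (ract O1 \<omega> z) a"
  unfolding form2_def Omega2_def using O1.forms_ract_pure by simp

lemma d_closed: "y \<in> carrier R \<Longrightarrow> d y \<in> carrier O1"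
  by (simp add: form1_closed unital_simps)

lemma d_linear: "form1 V R (\<zero>\<^bsub>R\<^esub>, \<one>\<^bsub>V\<^esub>) \<in> linear_maps V R O1"
  by (rule form1_linear(1)) (simp add: unital_simps)

lemma lact_d: "a \<in> carrier R \<Longrightarrow> y \<in> carrier R \<Longrightarrow> lact O1 a (d y) = form1 V R (a, \<zero>\<^bsub>V\<^esub>) y"
  by (simp add: lact_form1 unital_simps mult_zero)

text \<open>The right action on \<open>dy\<close> is defined by this rule solved for
  \<open>(dy) a\<close>; here it is solved back.\<close>

lemma d_mult:
  assumes a: "a \<in> carrier R" and y: "y \<in> carrier R"
  shows "d (y \<otimes>\<^bsub>R\<^esub> a) = ract O1 (d y) a \<oplus>\<^bsub>O1\<^esub> lact O1 y (d a)"
proof -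
  have "ract O1 (d y) a = d (y \<otimes>\<^bsub>R\<^esub> a) \<ominus>\<^bsub>O1\<^esub> lact O1 y (d a)"
    using a y by (simp add: ract_form1 lact_d unital_simps mult_zero)
  then show ?thesis
    using a y by (simp add: a_minus_def O1.E.M.a_assoc O1.E.M.l_neg d_closed mult_closed O1.lact_closed)
qed

section \<open>The degree filtration on 2-forms\<close>

definition gens2 :: "nat \<Rightarrow> ((('r \<times> 'v) \<times> 'r \<Rightarrow> 'v) set \<times> 'r \<Rightarrow> 'v) set set" where
  "gens2 r = {form2 V R (form1 V R u y) z | u y z i j k.
     i + j + k \<le> r \<and> u \<in> unital_part i \<and> y \<in> P j \<and> z \<in> P k}"

lemma gens2_closed: "gens2 r \<subseteq> carrier O2"
  using unital_part_closed by (auto simp: gens2_def intro!: form2_closed form1_closed power_sum_closed)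

lemma filtration2_eq: "F2 r = submodule_span V O2 (gens2 r)"
proof -
  have "gens2 r = {form2 V R (form1 V R (x, \<zero>\<^bsub>V\<^esub>) y) z | x y z i j k.
           i + j + k \<le> r \<and> x \<in> P i \<and> y \<in> P j \<and> z \<in> P k} \<union>
        {form2 V R (form1 V R (\<zero>\<^bsub>R\<^esub>, \<one>\<^bsub>V\<^esub>) y) z | y z j k.
           j + k \<le> r \<and> y \<in> P j \<and> z \<in> P k}" (is "_ = ?A \<union> ?B")
  proof (intro equalityI subsetI)
    fix t assume "t \<in> gens2 r"
    then obtain u y z i j k where t: "t = form2 V R (form1 V R u y) z" "i + j + k \<le> r"
      "u \<in> unital_part i" "y \<in> P j" "z \<in> P k" by (auto simp: gens2_def)
    have "t \<in> ?B" if "u = (\<zero>\<^bsub>R\<^esub>, \<one>\<^bsub>V\<^esub>)"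
    proof -
      have "j + k \<le> r" using t(2) by simp
      then show ?thesis using t that by blast
    qed
    moreover have "t \<in> ?A" if "u = (x, \<zero>\<^bsub>V\<^esub>)" "x \<in> P i" for x
      using t that by blast
    ultimately show "t \<in> ?A \<union> ?B" using t(3) by (auto simp: unital_part_def)
  next
    fix t assume "t \<in> ?A \<union> ?B"
    then show "t \<in> gens2 r"
    proof
      assume "t \<in> ?A"
      then show ?thesis unfolding gens2_def unital_part_def by blast
    next
      assume "t \<in> ?B"
      \<comment> \<open>The bound is stated with a leading 0, the value of \<open>i\<close> for a
        form whose coefficient is the adjoined unit.\<close>
      then obtain y z j k where "t = form2 V R (form1 V R (\<zero>\<^bsub>R\<^esub>, \<one>\<^bsub>V\<^esub>) y) z"
        "0 + j + k \<le> r" "y \<in> P j" "z \<in> P k" by auto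
      then show ?thesis unfolding gens2_def unital_part_def by blast
    qed
  qed
  then show ?thesis by (simp add: forms_filtration2_def)
qed

lemma filtration2_submodule: "submodule (F2 r) V O2"
  unfolding filtration2_eq by (rule O2.E.submodule_span_is_submodule[OF gens2_closed])

lemma filtration2_mono:
  assumes "r \<le> s"
  shows "F2 r \<subseteq> F2 s"
proof -
  have "gens2 r \<subseteq> gens2 s" using assms unfolding gens2_def by (blast intro: le_trans)
  then show ?thesis unfolding filtration2_eq by (rule O2.E.submodule_span_mono)
qed

lemma filtration2I:
  assumes "u \<in> unital_part i" "y \<in> P j" "z \<in> P k" "i + j + k \<le> r"
  shows "form2 V R (form1 V R u y) z \<in> F2 r"
proof -
  have "form2 V R (form1 V R u y) z \<in> gens2 r" using assms unfolding gens2_def by blast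
  then show ?thesis unfolding filtration2_eq using O2.E.submodule_span_superset by blast
qed

lemma linear_map_filtration2:
  assumes f: "f \<in> linear_maps V O2 O2" and N: "submodule N V O2"
    and gens: "\<And>u y z i j k. u \<in> unital_part i \<Longrightarrow> y \<in> P j \<Longrightarrow> z \<in> P k \<Longrightarrow> i + j + k \<le> r
      \<Longrightarrow> f (form2 V R (form1 V R u y) z) \<in> N"
    and \<eta>: "\<eta> \<in> F2 r"
  shows "f \<eta> \<in> N"
proof -
  interpret OO: two_modules V O2 O2 ..
  have "f ` gens2 r \<subseteq> N" using gens unfolding gens2_def by blast
  then show ?thesis
    using OO.linear_maps_span[OF f N gens2_closed] \<eta> unfolding filtration2_eq by blast
qed

lemma filtration2_lact:
  assumes a: "a \<in> P i" and \<eta>: "\<eta> \<in> F2 r"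
  shows "lact O2 a \<eta> \<in> F2 (i + r)"
proof (rule linear_map_filtration2[OF O2.lact_linear filtration2_submodule _ \<eta>])
  show aR: "a \<in> carrier R" by (rule power_sum_closed[OF a])
  fix u y z i' j k
  assume g: "u \<in> unital_part i'" "y \<in> P j" "z \<in> P k" "i' + j + k \<le> r"
  then have c: "u \<in> carrier U" "y \<in> carrier R" "z \<in> carrier R"
    using unital_part_closed power_sum_closed by blast+
  have "form2 V R (form1 V R (lact U a u) y) z \<in> F2 (i + r)"
    by (rule filtration2I[OF unital_part_lact[OF a g(1)] g(2,3)]) (use g(4) in simp)
  then show "lact O2 a (form2 V R (form1 V R u y) z) \<in> F2 (i + r)"
    using aR c by (simp add: lact_form2 lact_form1 form1_closed)
qed

text \<open>Applying the Leibniz rule twice gives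
  \<open>(u dy dz) a = u dy d(za) - u d(yz) da + (u y) dz da\<close>. Each term only redistributes
  the factors, so the total degree is at most \<open>r + i\<close>.\<close>

lemma filtration2_ract:
  assumes a: "a \<in> P i" and \<eta>: "\<eta> \<in> F2 r"
  shows "ract O2 \<eta> a \<in> F2 (r + i)"
proof (rule linear_map_filtration2[OF O2.ract_linear filtration2_submodule _ \<eta>])
  show aR: "a \<in> carrier R" by (rule power_sum_closed[OF a])
  fix u y z i' j k
  assume g: "u \<in> unital_part i'" "y \<in> P j" "z \<in> P k" "i' + j + k \<le> r"
  then have c: "u \<in> carrier U" "y \<in> carrier R" "z \<in> carrier R"
    using unital_part_closed power_sum_closed by blast+
  interpret OO: two_modules V O1 O2 ..
  have "form2 V R (form1 V R u y) (z \<otimes>\<^bsub>R\<^esub> a) \<in> F2 (r + i)"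
    by (rule filtration2I[OF g(1,2) power_sum_mult[OF g(3) a]]) (use g(4) in simp)
  moreover have "form2 V R (form1 V R u (y \<otimes>\<^bsub>R\<^esub> z)) a \<in> F2 (r + i)"
    by (rule filtration2I[OF g(1) power_sum_mult[OF g(2,3)] a]) (use g(4) in simp)
  moreover have "form2 V R (form1 V R (ract U u y) z) a \<in> F2 (r + i)"
    by (rule filtration2I[OF unital_part_ract[OF g(2,1)] g(3) a]) (use g(4) in simp)
  moreover have "form2 V R (ract O1 (form1 V R u y) z) a
      = form2 V R (form1 V R u (y \<otimes>\<^bsub>R\<^esub> z)) a \<ominus>\<^bsub>O2\<^esub> form2 V R (form1 V R (ract U u y) z) a"
    using aR c
    by (simp add: ract_form1 OO.linear_maps_minus[OF form2_linear(2)] form1_closed mult_closed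
        U.ract_closed)
  ultimately show "ract O2 (form2 V R (form1 V R u y) z) a \<in> F2 (r + i)"
    using aR c
    by (simp add: ract_form2 form1_closed O2.E.minus_in_submodule[OF filtration2_submodule])
qed

text \<open>The union of the chain is a submodule, so it suffices that it contains the forms
  \<open>u dy dz\<close>. Both tensor products are reduced to pure tensors, the inner one with
  \<open>z\<close> fixed.\<close>

lemma filtration2_exhausts:
  assumes gen: "(\<Union>n. P n) = carrier R"
  shows "carrier O2 \<subseteq> (\<Union>r. F2 r)"
proof -
  let ?N = "\<Union>r. F2 r"
  have N: "submodule ?N V O2"
    by (rule O2.E.submodule_Union_chain[OF filtration2_submodule filtration2_mono])
  have base: "form2 V R (form1 V R u y) z \<in> ?N"
    if u: "u \<in> unital_part i" and y: "y \<in> carrier R" and z: "z \<in> carrier R" for u y z i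
  proof -
    obtain j k where "y \<in> P j" "z \<in> P k" using gen y z by blast
    then show ?thesis using filtration2I[OF u _ _ order_refl] by blast
  qed
  have form: "form2 V R (form1 V R u y) z \<in> ?N"
    if u: "u \<in> carrier U" and y: "y \<in> carrier R" and z: "z \<in> carrier R" for u y z
  proof -
    obtain x c where xc: "u = (x, c)" "x \<in> carrier R" "c \<in> carrier V"
      using u by (auto simp: unital_simps)
    let ?f = "\<lambda>u. form2 V R (form1 V R u y) z"
    have f: "?f \<in> linear_maps V U O2"
      by (rule linear_maps_comp[OF form1_linear(2)[OF y] form2_linear(2)[OF z]])
    obtain i where "x \<in> P i" using gen xc(2) by blast
    then have "?f (x, \<zero>\<^bsub>V\<^esub>) \<in> ?N" by (intro base[of _ i] y z) (simp add: unital_part_def)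
    moreover have "?f (\<zero>\<^bsub>R\<^esub>, \<one>\<^bsub>V\<^esub>) \<in> ?N" by (intro base[of _ 0] y z) (simp add: unital_part_def)
    ultimately have "?f (x, \<zero>\<^bsub>V\<^esub>) \<oplus>\<^bsub>O2\<^esub> c \<odot>\<^bsub>O2\<^esub> ?f (\<zero>\<^bsub>R\<^esub>, \<one>\<^bsub>V\<^esub>) \<in> ?N"
      by (intro O2.E.submoduleE(5)[OF N] O2.E.submoduleE(4)[OF N] xc(3))
    \<comment> \<open>\<open>unital_part\<close> only has the unit itself next to elements of
      \<open>R\<close>; a general coefficient is a combination of these two kinds.\<close>
    moreover have "u = (x, \<zero>\<^bsub>V\<^esub>) \<oplus>\<^bsub>U\<^esub> c \<odot>\<^bsub>U\<^esub> (\<zero>\<^bsub>R\<^esub>, \<one>\<^bsub>V\<^esub>)"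
      using xc by (simp add: unital_simps)
    then have "?f u = ?f (x, \<zero>\<^bsub>V\<^esub>) \<oplus>\<^bsub>O2\<^esub> c \<odot>\<^bsub>O2\<^esub> ?f (\<zero>\<^bsub>R\<^esub>, \<one>\<^bsub>V\<^esub>)"
      using xc linear_maps_add[OF f, of "(x, \<zero>\<^bsub>V\<^esub>)" "c \<odot>\<^bsub>U\<^esub> (\<zero>\<^bsub>R\<^esub>, \<one>\<^bsub>V\<^esub>)"]
        linear_maps_smult[OF f xc(3), of "(\<zero>\<^bsub>R\<^esub>, \<one>\<^bsub>V\<^esub>)"]
      by (simp add: unital_simps)
    ultimately show ?thesis by simp
  qed
  interpret OO: two_modules V O1 O2 ..
  have "form2 V R \<omega> z \<in> ?N" if \<omega>: "\<omega> \<in> carrier O1" and z: "z \<in> carrier R" for \<omega> z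
  proof -
    have "submodule {\<omega> \<in> carrier O1. form2 V R \<omega> z \<in> ?N} V O1"
      by (rule OO.submodule_vimage[OF form2_linear(2)[OF z] N])
    then have "carrier (tensor V U R) \<subseteq> {\<omega> \<in> carrier O1. form2 V R \<omega> z \<in> ?N}"
      by (intro U.ER.tensor_span)
        (use form[OF _ _ z] form1_closed in \<open>simp_all add: form1_def Omega1_def\<close>)
    then show ?thesis using \<omega> by (auto simp: Omega1_def)
  qed
  then have "carrier (tensor V O1 R) \<subseteq> ?N"
    by (intro O1.ER.tensor_span) (use N in \<open>simp_all add: form2_def Omega2_def\<close>)
  then show ?thesis by (simp add: Omega2_def)
qed

text \<open>The products of length 0 allowed by \<open>generates\<close> are the identities of
  \<open>R\<close>. Having them in \<open>M\<close> places them in \<open>P 1\<close>; longer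
  products are words in \<open>M\<close> anyway.\<close>

lemma power_sum_exhausts:
  assumes S: "generates V R S" and sub: "S \<subseteq> M" "identities R \<subseteq> M"
  shows "(\<Union>n. P n) = carrier R"
proof -
  have "products R S i \<subseteq> (\<Union>n. P n)" for i
  proof (cases i)
    case 0
    then show ?thesis using sub(2) products_subset_power_sum[of 1 1] by auto
  next
    case (Suc k)
    have "products R S i \<subseteq> products R M i"
      by (rule products_mono[OF sub(1)]) (simp add: Suc)
    also have "\<dots> \<subseteq> P i" by (rule products_subset_power_sum) (simp_all add: Suc)
    finally show ?thesis by blast
  qed
  then have "submodule_span V R (\<Union>i. products R S i) \<subseteq> (\<Union>n. P n)"
    by (intro submodule_span_least submodule_Union_chain power_sum_submodule power_sum_mono UN_least)
  moreover have "submodule_span V R (\<Union>i. products R S i) = carrier R"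
    using S by (simp add: generates_def)
  ultimately show ?thesis using power_sum_closed by blast
qed

section \<open>The degree bound for a connection\<close>

lemma connection_finite_degree_on:
  assumes G: "finite G" "M = submodule_span V R G" "G \<subseteq> carrier R"
    and gen: "(\<Union>n. P n) = carrier R"
    and conn: "forms_connection V R nabla"
  shows "finite_degree_on V R M nabla"
proof -
  have lin: "nabla \<in> linear_maps V O1 O2"
    and lact: "\<And>a \<omega>. a \<in> carrier R \<Longrightarrow> \<omega> \<in> carrier O1 \<Longrightarrow> nabla (lact O1 a \<omega>) = lact O2 a (nabla \<omega>)"
    and ract: "\<And>a \<omega>. a \<in> carrier R \<Longrightarrow> \<omega> \<in> carrier O1
      \<Longrightarrow> nabla (ract O1 \<omega> a) = ract O2 (nabla \<omega>) a \<oplus>\<^bsub>O2\<^esub> form2 V R \<omega> a"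
    using conn by (simp_all add: forms_connection_def)
  have nd: "(\<lambda>y. nabla (d y)) \<in> linear_maps V R O2"
    by (rule linear_maps_comp[OF d_linear lin])
  interpret RO: two_modules V R O2 ..
  interpret OO: two_modules V O1 O2 ..
  have "\<exists>a. \<forall>g\<in>G. nabla (d g) \<in> F2 a"
    using G(1,3)
  proof (induction G)
    case (insert g G)
    then obtain a where a: "\<forall>g\<in>G. nabla (d g) \<in> F2 a" by auto
    have "nabla (d g) \<in> carrier O2" using insert.prems by (auto intro: linear_maps_closed[OF nd])
    then obtain b where "nabla (d g) \<in> F2 b" using filtration2_exhausts[OF gen] by blast
    then have "\<forall>h\<in>insert g G. nabla (d h) \<in> F2 (max a b)"
      using a filtration2_mono[of a "max a b"] filtration2_mono[of b "max a b"] by auto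
    then show ?case ..
  qed simp
  then obtain a where a: "\<forall>g\<in>G. nabla (d g) \<in> F2 a" ..
  \<comment> \<open>The bound passes from \<open>G\<close> to its span without changing
    \<open>a\<close>, because \<open>nabla (dm)\<close> is linear in \<open>m\<close> and
    \<open>F2 a\<close> is a submodule.\<close>
  have dM: "nabla (d m) \<in> F2 a" if "m \<in> M" for m
    using RO.linear_maps_span[OF nd filtration2_submodule G(3), of a] a that unfolding G(2) by blast
  \<comment> \<open>For a word \<open>m v\<close> of length \<open>n + 1\<close>, the three terms
    have degrees \<open>a + n\<close>, \<open>1 + n\<close> and \<open>1 + (n + a)\<close>. None
    exceeds \<open>Suc n + a\<close>, so the same \<open>a\<close> serves every length.\<close>
  have word: "nabla (d w) \<in> F2 (j + a)" if "1 \<le> j" "w \<in> products R M j" for j w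
    using that
  proof (induction j arbitrary: w rule: dec_induct)
    case base
    then show ?case using dM[of w] filtration2_mono[of a "1 + a"] by auto
  next
    case (step n)
    then obtain n' where n: "n = Suc n'" using not0_implies_Suc by fastforce
    then obtain m v where mv: "w = m \<otimes>\<^bsub>R\<^esub> v" "m \<in> M" "v \<in> products R M n"
      using step.prems by auto
    have m: "m \<in> P 1" "m \<in> carrier R"
      using mv(2) products_subset_power_sum[of 1 1] M_subset by auto
    have v: "v \<in> P n" "v \<in> carrier R"
      using mv(3) products_subset_power_sum[of n n] step.hyps power_sum_closed by auto
    have "ract O2 (nabla (d m)) v \<in> F2 (Suc n + a)"
      using filtration2_ract[OF v(1) dM[OF mv(2)]] filtration2_mono[of "a + n" "Suc n + a"] by auto
    moreover have "form2 V R (d m) v \<in> F2 (Suc n + a)"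
      by (rule filtration2I[of _ 0, OF _ m(1) v(1)]) (simp_all add: unital_part_def)
    moreover have "lact O2 m (nabla (d v)) \<in> F2 (Suc n + a)"
      using filtration2_lact[OF m(1) step.IH[OF mv(3)]] by simp
    moreover have "nabla (d w) = ract O2 (nabla (d m)) v \<oplus>\<^bsub>O2\<^esub> form2 V R (d m) v
        \<oplus>\<^bsub>O2\<^esub> lact O2 m (nabla (d v))"
      unfolding mv(1) using m(2) v(2)
      by (simp add: d_mult linear_maps_add[OF lin] d_closed O1.ract_closed O1.lact_closed lact ract)
    ultimately show ?case
      by (simp add: O2.E.submoduleE(5)[OF filtration2_submodule])
  qed
  have dP: "nabla (d y) \<in> F2 (j + a)" if "y \<in> P j" for y j
  proof (rule linear_map_power_sum[OF O2.E.module_axioms nd filtration2_submodule _ that])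
    show "nabla (d w) \<in> F2 (j + a)" if "1 \<le> i" "i \<le> j" "w \<in> products R M i" for i w
      using word[OF that(1,3)] filtration2_mono[of "i + a" "j + a"] that(2) by auto
  qed
  have "nabla ` F1 n \<subseteq> F2 (n + a)" for n
    unfolding forms_filtration1_def
  proof (rule OO.linear_maps_span[OF lin filtration2_submodule], goal_cases)
    case 1
    then show ?case by (auto intro!: form1_closed simp: unital_simps power_sum_closed)
  next
    case 2
    have "nabla (form1 V R (x, \<zero>\<^bsub>V\<^esub>) y) \<in> F2 (n + a)" if "i + j \<le> n" "x \<in> P i" "y \<in> P j" for x y i j
    proof -
      have c: "x \<in> carrier R" "y \<in> carrier R" using that power_sum_closed by auto
      \<comment> \<open>Left linearity takes \<open>x\<close> out of the connection; it adds its
        degree \<open>i\<close> to the degree \<open>j + a\<close> of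
        \<open>nabla (dy)\<close>.\<close>
      have "nabla (form1 V R (x, \<zero>\<^bsub>V\<^esub>) y) = lact O2 x (nabla (d y))"
        using c by (simp add: lact_d[symmetric] lact d_closed)
      then show ?thesis
        using filtration2_lact[OF that(2) dP[OF that(3)]] filtration2_mono[of "i + (j + a)" "n + a"] that(1)
        by auto
    qed
    moreover have "nabla (d y) \<in> F2 (n + a)" if "j \<le> n" "y \<in> P j" for y j
      using dP[OF that(2)] filtration2_mono[of "j + a" "n + a"] that(1) by auto
    ultimately show ?case by blast
  qed
  then show ?thesis unfolding finite_degree_on_def by blast
qed

end

text \<open>Two identities equal their product, so there is at most one. Adding it to a finite set
  of generators of \<open>M\<close> therefore keeps \<open>M\<close> bounded.\<close>

lemma (in nonunital_algebra) finite_identities: "finite (identities R)"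
proof (cases "identities R = {}")
  case False
  then obtain e where "e \<in> identities R" by blast
  then have "identities R \<subseteq> {e}" by (auto simp: identities_def)
  then show ?thesis by (rule finite_subset) simp
qed simp

lemma (in nonunital_algebra) connection_finite_degree:
  assumes S: "finite S" "generates V R S" and conn: "forms_connection V R nabla"
  shows "finite_degree V R (fine_bounded V R) nabla"
  unfolding finite_degree_def
proof (intro allI impI, elim conjE)
  fix A assume A: "A \<subseteq> carrier R" "fine_bounded V R A"
  then obtain F where F: "finite F" "F \<subseteq> carrier R" "A \<subseteq> submodule_span V R F"
    by (auto simp: fine_bounded_def)
  have gen: "S \<subseteq> carrier R" "submodule_span V R (\<Union>n. products R S n) = carrier R"
    using S(2) by (auto simp: generates_def)
  \<comment> \<open>\<open>F\<close> makes \<open>M\<close> contain \<open>A\<close>;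
    \<open>S\<close> and the identities make the powers of \<open>M\<close> exhaust
    \<open>R\<close>. All three are finite, so the span is bounded in the fine bornology.\<close>
  define G where "G = F \<union> S \<union> identities R"
  define M where "M = submodule_span V R G"
  have G: "finite G" "G \<subseteq> carrier R"
    using F S gen finite_identities by (auto simp: G_def identities_def)
  have M: "submodule M V R" unfolding M_def by (rule submodule_span_is_submodule[OF G(2)])
  then have deg: "degree_filtration V R M"
    by (intro degree_filtration.intro degree_filtration_axioms.intro nonunital_algebra_axioms)
  have "G \<subseteq> M" unfolding M_def by (rule submodule_span_superset)
  then have sub: "S \<subseteq> M" "identities R \<subseteq> M" by (auto simp: G_def)
  have "finite_degree_on V R M nabla"
    by (rule degree_filtration.connection_finite_degree_on[OF deg G(1) M_def G(2) _ conn])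
      (rule degree_filtration.power_sum_exhausts[OF deg S(2) sub])
  moreover have "A \<subseteq> M"
    using F(3) submodule_span_mono[of F G] by (auto simp: M_def G_def)
  moreover have "fine_bounded V R M"
    using G by (auto simp: fine_bounded_def M_def)
  ultimately show "\<exists>M. A \<subseteq> M \<and> submodule M V R \<and> fine_bounded V R M \<and> finite_degree_on V R M nabla"
    using M by blast
qed

theorem lemma8p2p3:
  fixes V :: "('v, 'z) ring_scheme" and R :: "('v, 'r, 'y) module_scheme" and S :: "'r set"
  assumes "complete_dvr V"
    and "nonunital_algebra V R"
    and "finite S" and "generates V R S"
    and "torsion_free V R"
    and "quasi_free V R"
    and "filtered_noetherian V (enveloping_algebra V R) (enveloping_filtration V R S)"
  shows "\<exists>nabla. forms_connection V R nabla \<and> finite_degree V R (fine_bounded V R) nabla"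
proof -
  interpret V: complete_dvr V by fact
  interpret nonunital_algebra V R by fact
  \<comment> \<open>That \<open>\<one>\<close> and \<open>\<zero>\<close> differ in the domain
    \<open>V\<close> is what the injective encoding of the extension relies on.\<close>
  from connection_exists[OF assms(6) V.one_not_zero]
  show ?thesis using connection_finite_degree[OF assms(3,4)] by blast
qed

end
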